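(* Let $k\ge 1$ and let $M$ be a $k$-tape classically-controlled quantum Turing machine operating in time $f(n)$, where $n$ is the input size. Then there exists a $2$-tape classically-controlled quantum Turing machine $M'$ operating in time $O(f(n)^2)$ such that for every input $\ket\psi$, $M(\ket\psi)=M'(\ket\psi)$.
   Context: A $k$-tape classically-controlled quantum Turing machine (CQTM), $k>0$, is a quintuple $M=(K,\Sigma_C,\Sigma_Q,\mathcal A,\delta)$: $K$ is a finite set of classical states with initial state $s$; $\Sigma_Q$ is a finite alphabet containing a blank $\#$ whose symbols label an orthonormal basis $\{\ket\tau\}$ of the Hilbert space of each quantum cell; each of the $k$ infinite tapes consists of such cells and has its own head; $\mathcal A$ is a finite set of $k$-cell admissible transformations, i.e. families $\{M_c\}_c$ of linear operators on $(\mathbb C^{|\Sigma_Q|})^{\otimes k}$ with $\sum_c M_c^\dagger M_c=\mathrm{Id}$, containing for each tape the blank test $\{\ket\#\bra\#, I-\ket\#\bra\#\}$ (outcomes $\#,\overline\#$) on that tape's cell; $\Sigma_C$ is a finite alphabet containing all outcomes of transformations in $\mathcal A$; and $\delta:K\times\Sigma_C\to(K\cup\{\text{yes},\text{no},h\})\times\{\leftarrow,\rightarrow,-\}^k\times\mathcal A$ is total. If $\delta(q,\tau)=(p,(D_1,\dots,D_k),A)$ and the machine is in state $q$ with last outcome $\tau$, the heads move according to $D_1,\dots,D_k$, then $A=\{M_c\}$ is applied to the $k$ pointed cells: outcome $c$ occurs with probability $\bra\psi M_c^\dagger M_c\ket\psi$ and the global state becomes $M_c\ket\psi$ normalized; the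 new state is $p$ and last outcome $c$. Each transition is one time step. The input state (a superposition of basis strings over $\Sigma_Q\setminus\{\#\}$ of length $n$) is placed on tape 1 on adjacent cells, all other cells are $\ket\#$, head 1 points to the blank cell immediately left of the input, the initial state is $s$ and the initial last outcome is $\#$. Reaching yes/no gives output yes/no; reaching $h$ gives as output the state of tape 1 from its leftmost non-$\ket\#$ cell to its rightmost non-$\ket\#$ cell. *)

theory Defs
  imports "HOL-Analysis.Analysis" "HOL-Library.Landau_Symbols"
begin

datatype target = TSt nat | TYes | TNo | THalt
datatype dir = DLeft | DRight | DStay

type_synonym qop = "nat list \<Rightarrow> nat list \<Rightarrow> complex"   (* matrix entries <x|M|y> *)
type_synonym transfo = "nat set \<times> (nat \<Rightarrow> qop)"            (* outcome set, operators M_c *)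
type_synonym tapes = "nat \<Rightarrow> int \<Rightarrow> nat"
type_synonym qstate = "tapes \<Rightarrow> complex"

record cqtm =
  states :: "nat set"
  start :: nat
  calph :: "nat set"
  qalph :: "nat set"
  ntapes :: nat
  transf :: "transfo set"
  delta :: "nat \<Rightarrow> nat \<Rightarrow> target \<times> dir list \<times> transfo"

definition cells :: "nat \<Rightarrow> nat set \<Rightarrow> nat list set" where
  "cells k \<Sigma> = {x. length x = k \<and> set x \<subseteq> \<Sigma>}"

definition admissible :: "nat \<Rightarrow> nat set \<Rightarrow> transfo \<Rightarrow> bool" where
  "admissible k \<Sigma> A \<longleftrightarrow>
     finite (fst A) \<and>
     (\<forall>c. c \<notin> fst A \<longrightarrow> snd A c = (\<lambda>x y. 0)) \<and>
     (\<forall>c x y. x \<notin> cells k \<Sigma> \<or> y \<notin> cells k \<Sigma> \<longrightarrow> snd A c x y = 0) \<and>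
     (\<forall>x\<in>cells k \<Sigma>. \<forall>y\<in>cells k \<Sigma>.
        (\<Sum>c\<in>fst A. \<Sum>z\<in>cells k \<Sigma>. cnj (snd A c z x) * snd A c z y) = (if x = y then 1 else 0))"

(* blank test {|#><#|, I - |#><#|} on tape j, outcomes # (=0) and #-bar (=1) *)
definition blank_test :: "nat \<Rightarrow> nat set \<Rightarrow> nat \<Rightarrow> transfo" where
  "blank_test k \<Sigma> j = ({0, 1}, (\<lambda>c x y.
      if x \<in> cells k \<Sigma> \<and> y \<in> cells k \<Sigma> \<and> x = y then
        (if c = 0 \<and> x ! j = 0 then 1 else if c = 1 \<and> x ! j \<noteq> 0 then 1 else 0)
      else 0))"

definition wf_cqtm :: "cqtm \<Rightarrow> bool" where
  "wf_cqtm M \<longleftrightarrow>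
     ntapes M > 0 \<and>
     finite (states M) \<and> start M \<in> states M \<and>
     finite (qalph M) \<and> 0 \<in> qalph M \<and>
     finite (calph M) \<and> 0 \<in> calph M \<and> 1 \<in> calph M \<and>
     finite (transf M) \<and>
     (\<forall>A\<in>transf M. admissible (ntapes M) (qalph M) A \<and> fst A \<subseteq> calph M) \<and>
     (\<forall>j<ntapes M. blank_test (ntapes M) (qalph M) j \<in> transf M) \<and>
     (\<forall>q\<in>states M. \<forall>c\<in>calph M.
        (case delta M q c of (p, D, A) \<Rightarrow>
           p \<in> TSt ` states M \<union> {TYes, TNo, THalt} \<and> length D = ntapes M \<and> A \<in> transf M))"

definition read_cells :: "nat \<Rightarrow> tapes \<Rightarrow> (nat \<Rightarrow> int) \<Rightarrow> nat list" where
  "read_cells k t h = map (\<lambda>j. t j (h j)) [0..<k]"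

definition upd_cells :: "nat \<Rightarrow> tapes \<Rightarrow> (nat \<Rightarrow> int) \<Rightarrow> nat list \<Rightarrow> tapes" where
  "upd_cells k t h ys = (\<lambda>j p. if j < k \<and> p = h j then ys ! j else t j p)"

definition apply_op :: "nat \<Rightarrow> nat set \<Rightarrow> qop \<Rightarrow> (nat \<Rightarrow> int) \<Rightarrow> qstate \<Rightarrow> qstate" where
  "apply_op k \<Sigma> Mc h \<psi> = (\<lambda>t. \<Sum>ys\<in>cells k \<Sigma>. Mc (read_cells k t h) ys * \<psi> (upd_cells k t h ys))"

definition move :: "nat \<Rightarrow> dir list \<Rightarrow> (nat \<Rightarrow> int) \<Rightarrow> (nat \<Rightarrow> int)" where
  "move k D h = (\<lambda>j. if j < k then h j + (case D ! j of DLeft \<Rightarrow> -1 | DRight \<Rightarrow> 1 | DStay \<Rightarrow> 0) else h j)"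

(* configuration: classical state, last outcome, head positions, unnormalized quantum state *)
type_synonym config = "target \<times> nat \<times> (nat \<Rightarrow> int) \<times> qstate"

definition step :: "cqtm \<Rightarrow> nat \<Rightarrow> config \<Rightarrow> nat \<Rightarrow> config" where
  "step M q cfg c = (case cfg of (_, c0, h, \<psi>) \<Rightarrow>
     (case delta M q c0 of (p, D, A) \<Rightarrow>
        let h' = move (ntapes M) D h in
        (p, c, h', apply_op (ntapes M) (qalph M) (snd A c) h' \<psi>)))"

fun exec :: "cqtm \<Rightarrow> config \<Rightarrow> nat list \<Rightarrow> config option" where
  "exec M cfg [] = Some cfg"
| "exec M cfg (c # cs) = (case fst cfg of TSt q \<Rightarrow> exec M (step M q cfg c) cs | _ \<Rightarrow> None)"

definition input_words :: "nat set \<Rightarrow> nat \<Rightarrow> nat list set" where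
  "input_words \<Sigma>in n = {w. length w = n \<and> set w \<subseteq> \<Sigma>in}"

definition valid_input :: "nat set \<Rightarrow> nat \<Rightarrow> (nat list \<Rightarrow> complex) \<Rightarrow> bool" where
  "valid_input \<Sigma>in n \<psi> \<longleftrightarrow>
     (\<forall>w. \<psi> w \<noteq> 0 \<longrightarrow> w \<in> input_words \<Sigma>in n) \<and>
     (\<Sum>w\<in>input_words \<Sigma>in n. (cmod (\<psi> w))\<^sup>2) = 1"

definition init_tapes :: "nat list \<Rightarrow> tapes" where
  "init_tapes w = (\<lambda>j p. if j = 0 \<and> 1 \<le> p \<and> p \<le> int (length w) then w ! (nat p - 1) else 0)"

definition init_config :: "cqtm \<Rightarrow> nat \<Rightarrow> (nat list \<Rightarrow> complex) \<Rightarrow> config" where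
  "init_config M n \<psi> = (TSt (start M), 0, (\<lambda>j. 0),
     (\<lambda>t. \<Sum>w\<in>input_words (qalph M - {0}) n. if t = init_tapes w then \<psi> w else 0))"

definition weight :: "qstate \<Rightarrow> real" where
  "weight \<psi> = (\<Sum>t\<in>{t. \<psi> t \<noteq> 0}. (cmod (\<psi> t))\<^sup>2)"

definition operates_in_time :: "cqtm \<Rightarrow> nat set \<Rightarrow> (nat \<Rightarrow> nat) \<Rightarrow> bool" where
  "operates_in_time M \<Sigma>in T \<longleftrightarrow>
     (\<forall>n \<psi>. valid_input \<Sigma>in n \<psi> \<longrightarrow>
        (\<forall>cs. set cs \<subseteq> calph M \<and> length cs = T n \<longrightarrow>
           (case exec M (init_config M n \<psi>) cs of
              None \<Rightarrow> True
            | Some (p, c, h, \<phi>) \<Rightarrow> (\<forall>q. p = TSt q \<longrightarrow> weight \<phi> = 0))))"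

(* reduced (unnormalized) density matrix of tape 0 restricted to the window from its
   leftmost to its rightmost cell not in state |#> *)
definition nonblank_pos :: "qstate \<Rightarrow> int set" where
  "nonblank_pos \<psi> = {p. \<exists>t. \<psi> t \<noteq> 0 \<and> t 0 p \<noteq> 0}"

definition out_window :: "qstate \<Rightarrow> int \<times> int" where
  "out_window \<psi> = (if nonblank_pos \<psi> = {} then (1, 0) else (Min (nonblank_pos \<psi>), Max (nonblank_pos \<psi>)))"

definition tape1_rho :: "qstate \<Rightarrow> nat list \<Rightarrow> nat list \<Rightarrow> complex" where
  "tape1_rho \<psi> x y = (case out_window \<psi> of (a, b) \<Rightarrow>
     let win = (\<lambda>t. map (\<lambda>i. t 0 (a + int i)) [0..<nat (b - a + 1)]);
         rest = (\<lambda>t. (\<lambda>j p. if j = 0 \<and> a \<le> p \<and> p \<le> b then 0 else t j p));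
         S = {t. \<psi> t \<noteq> 0}
     in (\<Sum>(t, t')\<in>S \<times> S. if win t = x \<and> win t' = y \<and> rest t = rest t'
                               then \<psi> t * cnj (\<psi> t') else 0))"

definition final_hists :: "cqtm \<Rightarrow> nat \<Rightarrow> (nat list \<Rightarrow> complex) \<Rightarrow> target \<Rightarrow> nat list set" where
  "final_hists M n \<psi> r = {cs. set cs \<subseteq> calph M \<and>
      (\<exists>c h \<phi>. exec M (init_config M n \<psi>) cs = Some (r, c, h, \<phi>))}"

definition final_qstate :: "cqtm \<Rightarrow> nat \<Rightarrow> (nat list \<Rightarrow> complex) \<Rightarrow> nat list \<Rightarrow> qstate" where
  "final_qstate M n \<psi> cs = (case exec M (init_config M n \<psi>) cs of
      Some (_, _, _, \<phi>) \<Rightarrow> \<phi> | None \<Rightarrow> (\<lambda>t. 0))"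

(* output of M on an input of length n: probability of yes, probability of no,
   and the (subnormalized) mixed output state of tape 1 on halting in h *)
definition cq_output :: "cqtm \<Rightarrow> nat \<Rightarrow> (nat list \<Rightarrow> complex) \<Rightarrow> real \<times> real \<times> (nat list \<Rightarrow> nat list \<Rightarrow> complex)" where
  "cq_output M n \<psi> =
     (infsum (\<lambda>cs. weight (final_qstate M n \<psi> cs)) (final_hists M n \<psi> TYes),
      infsum (\<lambda>cs. weight (final_qstate M n \<psi> cs)) (final_hists M n \<psi> TNo),
      (\<lambda>x y. infsum (\<lambda>cs. tape1_rho (final_qstate M n \<psi> cs) x y) (final_hists M n \<psi> THalt)))"

end

theory Submission
  imports Defs
begin

text \<open>
  \<open>M'\<close> keeps tape \<open>0\<close> of \<open>M\<close> unchanged and bundles the other \<open>k - 1\<close> tapes into the tracks of its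
  tape \<open>1\<close>, each track being displaced so that the head of \<open>M\<close> on it is at position \<open>0\<close>. A transformation
  of \<open>M\<close> then acts on just two cells, and a head move of \<open>M\<close> becomes a shift of a track. Shifts are
  carried out by sweeps over the part of tape \<open>1\<close> visited so far, with one symbol per track buffered in the
  cell under head \<open>0\<close>. Every cell of tape \<open>1\<close> carries a flag (\<open>0\<close> fresh, \<open>1\<close> visited, \<open>2\<close> centre); the
  flags are the same in all branches of a superposition, so that measuring them to steer a sweep does not
  disturb the state, and the rest of a sweep is a permutation of basis states. Hence the outcomes obtained
  while sweeping are determined, and the histories of \<open>M'\<close> of nonzero weight are those of \<open>M\<close> with fixed
  preludes of length \<open>10 m + 9\<close> inserted before the \<open>m\<close>-th outcome, whence the running time \<open>5 f (f + 1)\<close>.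
\<close>

section \<open>Executions and deterministic stretches\<close>

lemma exec_append:
  "exec M C (xs @ ys) = Option.bind (exec M C xs) (\<lambda>C'. exec M C' ys)"
  by (induction xs arbitrary: C) (auto split: target.split)

lemma apply_op_zero: "apply_op k \<Sigma> Mc h (\<lambda>t. 0) = (\<lambda>t. 0)"
  by (simp add: apply_op_def)

lemma step_zero:
  "\<exists>p' h'. step M q (p, c0, h, \<lambda>t. 0) c = (p', c, h', \<lambda>t. 0)"
  by (auto simp: step_def apply_op_zero Let_def split: prod.split)

lemma exec_zero:
  "exec M (p, c, h, \<lambda>t. 0) cs = Some (p', c', h', \<phi>) \<Longrightarrow> \<phi> = (\<lambda>t. 0)"
proof (induction cs arbitrary: p c h)
  case (Cons c1 cs)
  show ?case
  proof (cases p)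
    case (TSt q)
    then show ?thesis
      using Cons step_zero[of M q p c h c1] by auto
  qed (use Cons in auto)
qed auto

text \<open>A history that leaves \<open>os\<close> ends in the zero state, so \<open>os\<close> is
  the only course of nonzero weight. Both prefix directions occur because \<open>cs\<close> may stop
  before the end of \<open>os\<close> or run beyond it.\<close>

definition forced :: "cqtm \<Rightarrow> config \<Rightarrow> nat list \<Rightarrow> config \<Rightarrow> bool" where
  "forced M C os C' \<longleftrightarrow> exec M C os = Some C' \<and>
     (\<forall>cs p c h \<phi>. exec M C cs = Some (p, c, h, \<phi>) \<and> \<phi> \<noteq> (\<lambda>t. 0) \<longrightarrow>
        (\<exists>r. os = cs @ r \<or> cs = os @ r))"

lemma forced_append:
  assumes 1: "forced M C xs C1" and 2: "forced M C1 ys C2"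
  shows "forced M C (xs @ ys) C2"
  unfolding forced_def
proof (intro conjI allI impI)
  show "exec M C (xs @ ys) = Some C2"
    using assms by (simp add: forced_def exec_append)
next
  fix cs p c h \<phi>
  assume a: "exec M C cs = Some (p, c, h, \<phi>) \<and> \<phi> \<noteq> (\<lambda>t. 0)"
  then obtain r where "xs = cs @ r \<or> cs = xs @ r"
    using 1 unfolding forced_def by metis
  then show "\<exists>r. xs @ ys = cs @ r \<or> cs = (xs @ ys) @ r"
  proof
    assume "cs = xs @ r"
    moreover from this have "exec M C1 r = Some (p, c, h, \<phi>)"
      using a 1 by (simp add: forced_def exec_append)
    then have "\<exists>r'. ys = r @ r' \<or> r = ys @ r'"
      using a 2 by (auto simp: forced_def)
    ultimately show ?thesis by auto
  qed auto
qed

text \<open>The zero state persists through all later steps (\<open>exec_zero\<close>), so a history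
  that begins with an impossible outcome never recovers.\<close>

lemma forced_single:
  assumes "\<And>c. c \<noteq> c1 \<Longrightarrow> \<exists>p' c' h'. step M q (TSt q, c0, h, \<psi>) c = (p', c', h', \<lambda>t. 0)"
  shows "forced M (TSt q, c0, h, \<psi>) [c1] (step M q (TSt q, c0, h, \<psi>) c1)"
  unfolding forced_def
proof (intro conjI allI impI)
  fix cs p c h' \<phi>
  assume a: "exec M (TSt q, c0, h, \<psi>) cs = Some (p, c, h', \<phi>) \<and> \<phi> \<noteq> (\<lambda>t. 0)"
  show "\<exists>r. [c1] = cs @ r \<or> cs = [c1] @ r"
  proof (cases cs)
    case (Cons x xs)
    then have "x = c1"
      using a assms[of x] by simp (metis exec_zero)
    with Cons have "cs = [c1] @ xs" by simp
    then show ?thesis by blast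
  qed simp
qed simp

section \<open>Pushing a state forward along an injective relabelling of tapes\<close>

text \<open>The set \<open>S\<close> is kept explicit because the encoding of tapes used below
  forgets tapes beyond those of \<open>M\<close>, and so is injective only where these are
  blank.\<close>

definition represents :: "tapes set \<Rightarrow> (tapes \<Rightarrow> tapes) \<Rightarrow> qstate \<Rightarrow> qstate \<Rightarrow> bool" where
  "represents S F \<phi> \<phi>' \<longleftrightarrow> inj_on F S \<and> (\<forall>t. t \<notin> S \<longrightarrow> \<phi> t = 0) \<and>
     (\<forall>t\<in>S. \<phi>' (F t) = \<phi> t) \<and> (\<forall>t'. t' \<notin> F ` S \<longrightarrow> \<phi>' t' = 0)"

lemma represents_cong:
  assumes "represents S F \<phi> \<phi>'" "\<And>t. t \<in> S \<Longrightarrow> F t = G t"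
  shows "represents S G \<phi> \<phi>'"
proof -
  have "F ` S = G ` S"
    using assms(2) by (rule image_cong[OF refl])
  moreover have "inj_on F S = inj_on G S"
    using assms(2) by (rule inj_on_cong)
  ultimately show ?thesis using assms by (simp add: represents_def)
qed

text \<open>Tapes in \<open>S' - S\<close> have amplitude \<open>0\<close>, and injectivity on
  \<open>S'\<close> keeps their images off the image of \<open>S\<close>, outside which
  \<open>\<phi>'\<close> vanishes.\<close>

lemma represents_mono:
  assumes "represents S F \<phi> \<phi>'" "S \<subseteq> S'" "inj_on F S'"
  shows "represents S' F \<phi> \<phi>'"
  unfolding represents_def
proof (intro conjI allI ballI impI)
  fix t assume t: "t \<in> S'"
  show "\<phi>' (F t) = \<phi> t"
  proof (cases "t \<in> S")
    case False
    then have "F t \<notin> F ` S"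
      using assms(2,3) t by (auto simp: inj_on_def)
    then show ?thesis using assms(1) False by (simp add: represents_def)
  qed (use assms(1) in \<open>auto simp: represents_def\<close>)
qed (use assms in \<open>auto simp: represents_def image_iff subset_iff\<close>)

lemma represents_support:
  assumes "represents S F \<phi> \<phi>'"
  shows "{t'. \<phi>' t' \<noteq> 0} = F ` {t. \<phi> t \<noteq> 0}"
proof -
  have "t' \<in> F ` {t. \<phi> t \<noteq> 0}" if nz: "\<phi>' t' \<noteq> 0" for t'
  proof -
    from nz assms have "t' \<in> F ` S" unfolding represents_def by blast
    then obtain t where "t \<in> S" "t' = F t" by blast
    then show ?thesis using nz assms unfolding represents_def by auto
  qed
  moreover have "\<phi>' (F t) \<noteq> 0" if "\<phi> t \<noteq> 0" for t
  proof -
    from that assms have "t \<in> S" unfolding represents_def by blast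
    then show ?thesis using that assms unfolding represents_def by simp
  qed
  ultimately show ?thesis by auto
qed

lemma represents_inj_support:
  assumes "represents S F \<phi> \<phi>'"
  shows "inj_on F {t. \<phi> t \<noteq> 0}"
  using assms unfolding represents_def by (auto intro: inj_on_subset)

lemma represents_value:
  assumes "represents S F \<phi> \<phi>'" "\<phi> t \<noteq> 0"
  shows "\<phi>' (F t) = \<phi> t"
proof -
  from assms have "t \<in> S" unfolding represents_def by blast
  then show ?thesis using assms(1) unfolding represents_def by simp
qed

lemma represents_weight:
  assumes "represents S F \<phi> \<phi>'"
  shows "weight \<phi>' = weight \<phi>"
proof -
  have "weight \<phi>' = (\<Sum>t\<in>{t. \<phi> t \<noteq> 0}. (cmod (\<phi>' (F t)))\<^sup>2)"
    unfolding weight_def represents_support[OF assms]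
    by (simp add: sum.reindex[OF represents_inj_support[OF assms]])
  also have "\<dots> = weight \<phi>"
    unfolding weight_def
    by (intro sum.cong refl) (simp add: represents_value[OF assms])
  finally show ?thesis .
qed

lemma represents_zero_iff:
  assumes "represents S F \<phi> \<phi>'"
  shows "\<phi>' = (\<lambda>t. 0) \<longleftrightarrow> \<phi> = (\<lambda>t. 0)"
proof -
  have "{t'. \<phi>' t' \<noteq> 0} = {} \<longleftrightarrow> {t. \<phi> t \<noteq> 0} = {}"
    unfolding represents_support[OF assms] by simp
  then show ?thesis by (auto simp: fun_eq_iff)
qed

text \<open>The window depends on tape \<open>0\<close> alone, and the partial trace only compares
  the remaining cells for equality. A relabelling that fixes tape \<open>0\<close> and respects
  equality of the other tapes in both directions thus leaves the reduced density matrix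
  unchanged.\<close>

lemma represents_tape1_rho:
  assumes r: "represents S F \<phi> \<phi>'"
    and tape0: "\<And>t. t \<in> S \<Longrightarrow> F t 0 = t 0"
    and others: "\<And>t t'. t \<in> S \<Longrightarrow> t' \<in> S \<Longrightarrow>
      (\<forall>j. j \<noteq> 0 \<longrightarrow> F t j = F t' j) \<longleftrightarrow> (\<forall>j. j \<noteq> 0 \<longrightarrow> t j = t' j)"
  shows "tape1_rho \<phi>' x y = tape1_rho \<phi> x y"
proof -
  let ?s = "{t. \<phi> t \<noteq> 0}"
  have sS: "t \<in> S" if "t \<in> ?s" for t
    using r that unfolding represents_def by auto
  note supp = represents_support[OF r]
  have supp': "\<phi>' t' \<noteq> 0 \<longleftrightarrow> (\<exists>t\<in>?s. t' = F t)" for t'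
    using supp by blast
  have nb: "nonblank_pos \<phi>' = nonblank_pos \<phi>"
    unfolding nonblank_pos_def supp' using sS tape0 by (auto; metis)
  then have ow: "out_window \<phi>' = out_window \<phi>"
    by (simp add: out_window_def)
  obtain a b where ab: "out_window \<phi> = (a, b)" by force
  define win where "win = (\<lambda>t::tapes. map (\<lambda>i. t 0 (a + int i)) [0..<nat (b - a + 1)])"
  define rest where "rest = (\<lambda>(t::tapes) j p. if j = 0 \<and> a \<le> p \<and> p \<le> b then 0 else t j p)"
  have rest_iff: "rest t = rest t' \<longleftrightarrow>
      (\<forall>p. \<not> (a \<le> p \<and> p \<le> b) \<longrightarrow> t 0 p = t' 0 p) \<and> (\<forall>j. j \<noteq> 0 \<longrightarrow> t j = t' j)" for t t'
    unfolding rest_def fun_eq_iff by (smt (verit))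
  have winF: "win (F t) = win t" if "t \<in> ?s" for t
    using tape0[OF sS[OF that]] by (simp add: win_def)
  have restF: "rest (F t) = rest (F t') \<longleftrightarrow> rest t = rest t'" if "t \<in> ?s" "t' \<in> ?s" for t t'
    unfolding rest_iff using tape0 others sS that by simp
  have inj: "inj_on (map_prod F F) (?s \<times> ?s)"
    using represents_inj_support[OF r] by (simp add: map_prod_inj_on)
  have "tape1_rho \<phi>' x y = (\<Sum>(t, t')\<in>map_prod F F ` (?s \<times> ?s).
      if win t = x \<and> win t' = y \<and> rest t = rest t' then \<phi>' t * cnj (\<phi>' t') else 0)"
    unfolding tape1_rho_def ow ab supp
    by (simp add: Let_def win_def rest_def map_prod_surj_on)
  also have "\<dots> = (\<Sum>(t, t')\<in>?s \<times> ?s.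
      if win t = x \<and> win t' = y \<and> rest t = rest t' then \<phi> t * cnj (\<phi> t') else 0)"
    unfolding sum.reindex[OF inj]
    by (intro sum.cong refl) (auto simp: winF restF represents_value[OF r])
  also have "\<dots> = tape1_rho \<phi> x y"
    unfolding tape1_rho_def ab by (simp add: Let_def win_def rest_def)
  finally show ?thesis .
qed

section \<open>Two kinds of admissible transformations\<close>

lemma finite_cells: "finite \<Sigma> \<Longrightarrow> finite (cells k \<Sigma>)"
  unfolding cells_def by (rule finite_subset[OF _ finite_lists_length_eq[of \<Sigma> k]]) auto

text \<open>The map \<open>g\<close> alone need not be injective: outcomes are measured, so it suffices that \<open>(g, out)\<close> is.\<close>

definition perm_transfo ::
  "nat \<Rightarrow> nat set \<Rightarrow> nat set \<Rightarrow> (nat list \<Rightarrow> nat list) \<Rightarrow> (nat list \<Rightarrow> nat) \<Rightarrow> transfo" where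
  "perm_transfo k \<Sigma> C g out = (C, \<lambda>c x y.
     if x \<in> cells k \<Sigma> \<and> y \<in> cells k \<Sigma> \<and> c \<in> C \<and> x = g y \<and> out y = c then 1 else 0)"

text \<open>The column of \<open>y\<close>, stacked over all outcomes, has a single entry
  \<open>1\<close>, in row \<open>g y\<close> of the operator for outcome \<open>out y\<close>. Such
  columns are orthonormal when these positions are distinct.\<close>

lemma perm_transfo_admissible:
  assumes fin: "finite \<Sigma>" "finite C"
    and g: "\<And>y. y \<in> cells k \<Sigma> \<Longrightarrow> g y \<in> cells k \<Sigma>" and out: "\<And>y. y \<in> cells k \<Sigma> \<Longrightarrow> out y \<in> C"
    and inj: "inj_on (\<lambda>y. (g y, out y)) (cells k \<Sigma>)"
  shows "admissible k \<Sigma> (perm_transfo k \<Sigma> C g out)"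
  unfolding admissible_def
proof (intro conjI allI impI ballI)
  fix x y assume x: "x \<in> cells k \<Sigma>" and y: "y \<in> cells k \<Sigma>"
  let ?B = "snd (perm_transfo k \<Sigma> C g out)"
  have "(\<Sum>c\<in>C. \<Sum>z\<in>cells k \<Sigma>. cnj (?B c z x) * ?B c z y)
      = (\<Sum>c\<in>C. \<Sum>z\<in>cells k \<Sigma>. if z = g x then
           (if c = out x then (if g x = g y \<and> out x = out y then 1 else 0) else 0) else 0)"
    using x y by (intro sum.cong refl) (auto simp: perm_transfo_def)
  also have "\<dots> = (if g x = g y \<and> out x = out y then 1 else 0)"
    using fin g[OF x] out[OF x] by (simp add: finite_cells sum.delta)
  also have "\<dots> = (if x = y then 1 else 0)"
    using inj x y by (auto simp: inj_on_def)
  finally show "(\<Sum>c\<in>fst (perm_transfo k \<Sigma> C g out). \<Sum>z\<in>cells k \<Sigma>. cnj (?B c z x) * ?B c z y)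
      = (if x = y then 1 else 0)"
    by (simp add: perm_transfo_def)
qed (use fin in \<open>auto simp: perm_transfo_def fun_eq_iff\<close>)

lemma blank_test_eq_perm_transfo:
  "blank_test k \<Sigma> j = perm_transfo k \<Sigma> {0, 1} (\<lambda>y. y) (\<lambda>y. if y ! j = 0 then 0 else 1)"
  unfolding blank_test_def perm_transfo_def by (auto simp: fun_eq_iff)

lemma blank_test_admissible: "finite \<Sigma> \<Longrightarrow> admissible k \<Sigma> (blank_test k \<Sigma> j)"
  unfolding blank_test_eq_perm_transfo
  by (rule perm_transfo_admissible) (auto simp: inj_on_def)

lemma read_upd_cells: "length ys = k \<Longrightarrow> read_cells k (upd_cells k t h ys) h = ys"
  by (auto simp: read_cells_def upd_cells_def intro: nth_equalityI)

lemma upd_read_cells: "upd_cells k t h (read_cells k t h) = t"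
  by (auto simp: read_cells_def upd_cells_def fun_eq_iff)

lemma upd_upd_cells: "upd_cells k (upd_cells k t h xs) h ys = upd_cells k t h ys"
  by (auto simp: upd_cells_def fun_eq_iff)

lemma cells_length: "x \<in> cells k \<Sigma> \<Longrightarrow> length x = k"
  by (simp add: cells_def)

text \<open>The outcome is the same on the whole represented support, so the measurement reveals
  nothing: outcome \<open>c\<close> acts as a relabelling, and every other outcome annihilates the
  state.\<close>

lemma perm_transfo_represents:
  assumes fin: "finite \<Sigma>"
    and g: "\<And>y. y \<in> cells k \<Sigma> \<Longrightarrow> g y \<in> cells k \<Sigma>"
    and inj: "inj_on (\<lambda>y. (g y, out y)) (cells k \<Sigma>)"
    and r: "represents S F \<phi> \<phi>'"
    and rd: "\<And>t. t \<in> S \<Longrightarrow> read_cells k (F t) h \<in> cells k \<Sigma>"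
    and out: "\<And>t. t \<in> S \<Longrightarrow> out (read_cells k (F t) h) = c" and cC: "c \<in> C"
  shows "represents S (\<lambda>t. upd_cells k (F t) h (g (read_cells k (F t) h))) \<phi>
          (apply_op k \<Sigma> (snd (perm_transfo k \<Sigma> C g out) c) h \<phi>')"
    and "c' \<noteq> c \<Longrightarrow> apply_op k \<Sigma> (snd (perm_transfo k \<Sigma> C g out) c') h \<phi>' = (\<lambda>t. 0)"
proof -
  let ?B = "snd (perm_transfo k \<Sigma> C g out)"
  let ?G = "\<lambda>t. upd_cells k (F t) h (g (read_cells k (F t) h))"
  let ?\<chi> = "\<lambda>d. apply_op k \<Sigma> (?B d) h \<phi>'"
  have lg: "length (g (read_cells k (F t) h)) = k" if "t \<in> S" for t
    using g[OF rd[OF that]] by (rule cells_length)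
  have rdG: "read_cells k (?G t) h = g (read_cells k (F t) h)" if "t \<in> S" for t
    by (rule read_upd_cells[OF lg[OF that]])
  \<comment> \<open>A nonzero amplitude at \<open>t'\<close> has a source in the support of
    \<open>\<phi>'\<close>; this identifies \<open>t'\<close> as updated tapes and the outcome as
    \<open>c\<close>.\<close>
  have hit: "t' \<in> ?G ` S \<and> d = c" if nz: "?\<chi> d t' \<noteq> 0" for t' d
  proof -
    from nz obtain ys where ys: "ys \<in> cells k \<Sigma>" and B: "?B d (read_cells k t' h) ys \<noteq> 0"
      and \<phi>': "\<phi>' (upd_cells k t' h ys) \<noteq> 0"
      unfolding apply_op_def by (auto elim: sum.not_neutral_contains_not_neutral)
    from \<phi>' r have "upd_cells k t' h ys \<in> F ` S"
      unfolding represents_def by blast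
    then obtain t where t: "t \<in> S" "upd_cells k t' h ys = F t"
      by blast
    have yF: "ys = read_cells k (F t) h"
      using read_upd_cells[OF cells_length[OF ys]] t(2) by metis
    from B have "read_cells k t' h = g ys" and d: "out ys = d"
      by (auto simp: perm_transfo_def split: if_splits)
    then have "t' = ?G t"
      using upd_upd_cells[of k t' h ys "g ys"] upd_read_cells[of k t' h] t(2) yF by metis
    then show ?thesis using t(1) d out[OF t(1)] yF by auto
  qed
  have fwd: "?\<chi> c (?G t) = \<phi> t" if t: "t \<in> S" for t
  proof -
    let ?y = "read_cells k (F t) h"
    have "?\<chi> c (?G t) = (\<Sum>ys\<in>cells k \<Sigma>. if ys = ?y then \<phi>' (F t) else 0)"
      unfolding apply_op_def
    proof (intro sum.cong refl)
      fix ys assume ys: "ys \<in> cells k \<Sigma>"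
      \<comment> \<open>Injectivity of \<open>g\<close> paired with \<open>out\<close> leaves one
        contributing source.\<close>
      have "g ?y = g ys \<and> out ys = c \<longleftrightarrow> ys = ?y"
        using inj rd[OF t] out[OF t] ys by (auto simp: inj_on_def)
      then show "?B c (read_cells k (?G t) h) ys * \<phi>' (upd_cells k (?G t) h ys)
          = (if ys = ?y then \<phi>' (F t) else 0)"
        using ys g[OF rd[OF t]] rd[OF t] cC
        by (auto simp: perm_transfo_def rdG[OF t] upd_upd_cells upd_read_cells)
    qed
    also have "\<dots> = \<phi> t"
      using fin rd[OF t] r t by (simp add: finite_cells represents_def)
    finally show ?thesis .
  qed
  have "inj_on ?G S"
  proof (rule inj_onI)
    fix t1 t2 assume t: "t1 \<in> S" "t2 \<in> S" and e: "?G t1 = ?G t2"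
    then have "g (read_cells k (F t1) h) = g (read_cells k (F t2) h)"
      using rdG by metis
    then have y: "read_cells k (F t1) h = read_cells k (F t2) h"
      using inj rd out t by (auto simp: inj_on_def)
    have "F t = upd_cells k (?G t) h (read_cells k (F t) h)" for t
      by (simp add: upd_upd_cells upd_read_cells)
    then have "F t1 = F t2" using e y by metis
    then show "t1 = t2" using r t by (auto simp: represents_def inj_on_def)
  qed
  then show "represents S ?G \<phi> (?\<chi> c)"
    using fwd hit r unfolding represents_def by blast
  show "?\<chi> c' = (\<lambda>t. 0)" if "c' \<noteq> c"
    using hit that by blast
qed

text \<open>Off the image of \<open>\<iota>\<close> the identity, with outcome \<open>0\<close>, completes the transformation.\<close>

definition embed_transfo ::
  "nat \<Rightarrow> nat set \<Rightarrow> nat \<Rightarrow> nat set \<Rightarrow> 'l set \<Rightarrow> (nat list \<times> 'l \<Rightarrow> nat list) \<Rightarrow> transfo \<Rightarrow> transfo" where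
  "embed_transfo k \<Sigma> k' \<Sigma>' L \<iota> A = (insert 0 (fst A), \<lambda>c x y.
     let V = \<iota> ` (cells k \<Sigma> \<times> L); \<beta> = inv_into (cells k \<Sigma> \<times> L) \<iota> in
     if x \<in> V \<and> y \<in> V then (if snd (\<beta> x) = snd (\<beta> y) then snd A c (fst (\<beta> x)) (fst (\<beta> y)) else 0)
     else if x \<in> cells k' \<Sigma>' \<and> x = y \<and> c = 0 then 1 else 0)"

lemma embed_transfo_on_image:
  assumes "inj_on \<iota> (cells k \<Sigma> \<times> L)" "x \<in> cells k \<Sigma>" "y \<in> cells k \<Sigma>" "l \<in> L" "l' \<in> L"
  shows "snd (embed_transfo k \<Sigma> k' \<Sigma>' L \<iota> A) c (\<iota> (x, l)) (\<iota> (y, l')) = (if l = l' then snd A c x y else 0)"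
  using assms by (simp add: embed_transfo_def Let_def inv_into_f_f)

lemma embed_transfo_off_image:
  assumes "x \<notin> \<iota> ` (cells k \<Sigma> \<times> L) \<or> y \<notin> \<iota> ` (cells k \<Sigma> \<times> L)"
  shows "snd (embed_transfo k \<Sigma> k' \<Sigma>' L \<iota> A) c x y = (if x \<in> cells k' \<Sigma>' \<and> x = y \<and> c = 0 then 1 else 0)"
  using assms by (auto simp: embed_transfo_def Let_def)

text \<open>The operators are block diagonal: a copy of \<open>A\<close> for each label in
  \<open>L\<close>, and an identity block off the image of \<open>\<iota>\<close>. Completeness
  holds in each block separately.\<close>

lemma embed_transfo_admissible:
  fixes \<iota> :: "nat list \<times> 'l \<Rightarrow> nat list"
  assumes A: "admissible k \<Sigma> A" and inj: "inj_on \<iota> (cells k \<Sigma> \<times> L)"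
    and im: "\<iota> ` (cells k \<Sigma> \<times> L) \<subseteq> cells k' \<Sigma>'" and fin: "finite \<Sigma>" "finite \<Sigma>'" "finite L"
  shows "admissible k' \<Sigma>' (embed_transfo k \<Sigma> k' \<Sigma>' L \<iota> A)"
proof -
  let ?V = "\<iota> ` (cells k \<Sigma> \<times> L)" and ?E = "embed_transfo k \<Sigma> k' \<Sigma>' L \<iota> A"
  note on = embed_transfo_on_image[OF inj]
  have off: "x \<notin> ?V \<or> y \<notin> ?V \<Longrightarrow>
      snd ?E c x y = (if x \<in> cells k' \<Sigma>' \<and> x = y \<and> c = 0 then 1 else 0)" for c x y
    by (rule embed_transfo_off_image)
  have fA: "finite (fst A)" and A0: "\<And>c. c \<notin> fst A \<Longrightarrow> snd A c = (\<lambda>x y. 0)"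
    using A by (auto simp: admissible_def)
  have fE: "fst ?E = insert 0 (fst A)" by (simp add: embed_transfo_def)
  have sum: "(\<Sum>c\<in>fst ?E. \<Sum>z\<in>cells k' \<Sigma>'. cnj (snd ?E c z x) * snd ?E c z y) = (if x = y then 1 else 0)"
    if x: "x \<in> cells k' \<Sigma>'" and y: "y \<in> cells k' \<Sigma>'" for x y
  proof -
    consider "x \<in> ?V" "y \<in> ?V" | "x \<in> ?V" "y \<notin> ?V" | "x \<notin> ?V" "y \<in> ?V" | "x \<notin> ?V" "y \<notin> ?V" by blast
    then show ?thesis
    proof cases
      case 1
      then obtain p l q l' where p: "x = \<iota> (p, l)" "p \<in> cells k \<Sigma>" "l \<in> L"
        and q: "y = \<iota> (q, l')" "q \<in> cells k \<Sigma>" "l' \<in> L" by auto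
      have inner: "(\<Sum>z\<in>cells k' \<Sigma>'. cnj (snd ?E c z x) * snd ?E c z y)
          = (if l = l' then \<Sum>r\<in>cells k \<Sigma>. cnj (snd A c r p) * snd A c r q else 0)" for c
      proof -
        \<comment> \<open>A column belonging to the image has no entries outside it.\<close>
        have "(\<Sum>z\<in>cells k' \<Sigma>'. cnj (snd ?E c z x) * snd ?E c z y)
            = (\<Sum>z\<in>?V. cnj (snd ?E c z x) * snd ?E c z y)"
          using im fin 1 by (intro sum.mono_neutral_right) (auto simp: finite_cells off)
        also have "\<dots> = (\<Sum>(r, g)\<in>cells k \<Sigma> \<times> L. if g = l then
            (if l = l' then cnj (snd A c r p) * snd A c r q else 0) else 0)"
          unfolding sum.reindex[OF inj] p(1) q(1)
          by (intro sum.cong refl) (auto simp: on p q)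
        also have "\<dots> = (if l = l' then \<Sum>r\<in>cells k \<Sigma>. cnj (snd A c r p) * snd A c r q else 0)"
          using fin(3) p(3) by (simp add: sum.cartesian_product[symmetric])
        finally show ?thesis .
      qed
      \<comment> \<open>If \<open>0\<close> is not an outcome of \<open>A\<close>, its operator is
        zero there, so the added outcome contributes nothing to this block.\<close>
      have "(\<Sum>c\<in>fst ?E. \<Sum>r\<in>cells k \<Sigma>. cnj (snd A c r p) * snd A c r q)
          = (\<Sum>c\<in>fst A. \<Sum>r\<in>cells k \<Sigma>. cnj (snd A c r p) * snd A c r q)"
        unfolding fE using fA A0 by (intro sum.mono_neutral_right) auto
      also have "\<dots> = (if p = q then 1 else 0)"
        using A p q by (simp add: admissible_def)
      finally have "(\<Sum>c\<in>fst ?E. \<Sum>z\<in>cells k' \<Sigma>'. cnj (snd ?E c z x) * snd ?E c z y)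
          = (if l = l' \<and> p = q then 1 else 0)"
        unfolding inner by (cases "l = l'") auto
      also have "\<dots> = (if x = y then 1 else 0)"
        using inj p q by (auto simp: inj_on_def)
      finally show ?thesis .
    next
      case 2
      then have "cnj (snd ?E c z x) * snd ?E c z y = 0" for c z
        by (auto simp: off)
      then have "(\<Sum>c\<in>fst ?E. \<Sum>z\<in>cells k' \<Sigma>'. cnj (snd ?E c z x) * snd ?E c z y) = 0"
        by (intro sum.neutral ballI)
      moreover have "x \<noteq> y" using 2 by blast
      ultimately show ?thesis by presburger
    next
      case 3
      then have "cnj (snd ?E c z x) * snd ?E c z y = 0" for c z
        by (auto simp: off)
      then have "(\<Sum>c\<in>fst ?E. \<Sum>z\<in>cells k' \<Sigma>'. cnj (snd ?E c z x) * snd ?E c z y) = 0"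
        by (intro sum.neutral ballI)
      moreover have "x \<noteq> y" using 3 by blast
      ultimately show ?thesis by presburger
    next
      case 4
      then have "(\<Sum>c\<in>fst ?E. \<Sum>z\<in>cells k' \<Sigma>'. cnj (snd ?E c z x) * snd ?E c z y)
          = (\<Sum>c\<in>fst ?E. \<Sum>z\<in>cells k' \<Sigma>'. if z = x then (if c = 0 then (if x = y then 1 else 0) else 0) else 0)"
        using x y by (intro sum.cong refl) (auto simp: off)
      also have "\<dots> = (if x = y then 1 else 0)"
        using fin fA x by (simp add: finite_cells fE)
      finally show ?thesis .
    qed
  qed
  have off_cells: "snd ?E c x y = 0" if "x \<notin> cells k' \<Sigma>' \<or> y \<notin> cells k' \<Sigma>'" for c x y
    using that im by (subst off) auto
  have off_outcomes: "snd ?E c = (\<lambda>x y. 0)" if "c \<notin> fst ?E" for c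
    using that A0 unfolding fE by (auto simp: embed_transfo_def Let_def fun_eq_iff)
  show ?thesis
    unfolding admissible_def
    by (intro conjI allI impI ballI sum off_cells off_outcomes) (simp_all add: fE fA)
qed

section \<open>The simulating machine\<close>

locale simulation =
  fixes M :: cqtm
  assumes wf: "wf_cqtm M"
begin

definition w :: nat where "w = ntapes M - 1"
definition pad :: "nat list" where "pad = replicate w 0"
definition blocks :: "nat list set" where "blocks = cells w (qalph M)"

text \<open>
  A tape-\<open>0\<close> symbol together with a blank buffer is coded by the symbol itself, so tape \<open>0\<close> is literally that of
  \<open>M\<close> between sweeps. Likewise a fresh blank cell of tape \<open>1\<close> is coded by the blank \<open>0\<close>.
\<close>

definition code0 :: "nat \<Rightarrow> nat list \<Rightarrow> nat" where
  "code0 a b = (if b = pad then a else Suc (Max (qalph M)) + to_nat (a, b))"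

definition code1 :: "nat list \<Rightarrow> nat \<Rightarrow> nat" where
  "code1 u f = (if u = pad \<and> f = 0 then 0 else Suc (to_nat (u, f)))"

text \<open>All tapes share one alphabet. Codes of the two kinds may coincide as numbers; the tape
  on which a symbol stands determines how it is read.\<close>

definition alph2 :: "nat set" where
  "alph2 = (\<lambda>(a, b). code0 a b) ` (qalph M \<times> blocks) \<union> (\<lambda>(u, f). code1 u f) ` (blocks \<times> {0, 1, 2})"

definition pair_code :: "nat \<times> nat list \<times> nat list \<times> nat \<Rightarrow> nat list" where
  "pair_code = (\<lambda>(a, b, u, f). [code0 a b, code1 u f])"

definition quads :: "(nat \<times> nat list \<times> nat list \<times> nat) set" where
  "quads = qalph M \<times> blocks \<times> blocks \<times> {0, 1, 2}"

definition mix :: "(nat \<Rightarrow> bool) \<Rightarrow> nat list \<Rightarrow> nat list \<Rightarrow> nat list" where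
  "mix \<mu> u b = map (\<lambda>j. if \<mu> j then u ! j else b ! j) [0..<w]"

text \<open>Exchanging buffer and block on the tracks in \<open>\<mu>\<close> is reversible, and
  repeated under a moving head it displaces these tracks by one cell. The flag update
  \<open>s\<close> may lose information, which the measured old flag retains.\<close>

definition swap_quad ::
  "(nat \<Rightarrow> bool) \<Rightarrow> (nat \<Rightarrow> nat) \<Rightarrow> nat \<times> nat list \<times> nat list \<times> nat \<Rightarrow> nat \<times> nat list \<times> nat list \<times> nat" where
  "swap_quad \<mu> s = (\<lambda>(a, b, u, f). (a, mix \<mu> u b, mix \<mu> b u, s f))"

definition swap_cells :: "(nat \<Rightarrow> bool) \<Rightarrow> (nat \<Rightarrow> nat) \<Rightarrow> nat list \<Rightarrow> nat list" where
  "swap_cells \<mu> s z = (if z \<in> pair_code ` quads then pair_code (swap_quad \<mu> s (inv_into quads pair_code z)) else z)"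

text \<open>The value \<open>0\<close> on pairs that are no codes is a filler that keeps the outcome
  among the three flags.\<close>

definition flag_of :: "nat list \<Rightarrow> nat" where
  "flag_of z = (if z \<in> pair_code ` quads then snd (snd (snd (inv_into quads pair_code z))) else 0)"

definition shift_op :: "(nat \<Rightarrow> bool) \<Rightarrow> (nat \<Rightarrow> nat) \<Rightarrow> transfo" where
  "shift_op \<mu> s = perm_transfo 2 alph2 {0, 1, 2} (swap_cells \<mu> s) flag_of"

definition merge_code :: "nat list \<times> nat \<Rightarrow> nat list" where
  "merge_code = (\<lambda>(v, f). [hd v, code1 (tl v) f])"

text \<open>The flag serves as the label: \<open>A\<close> acts in the same way under each flag and
  never mixes flags.\<close>

definition lift_op :: "transfo \<Rightarrow> transfo" where
  "lift_op A = embed_transfo (ntapes M) (qalph M) 2 alph2 {0, 1, 2} merge_code A"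

text \<open>
  \<open>st q 0 5\<close> represents state \<open>q\<close> of \<open>M\<close>. In \<open>st q c i\<close> with \<open>i \<le> 4\<close> the machine is about to simulate \<open>\<delta>(q, c)\<close>:
  \<open>i = 0\<close> after marking the centre, and \<open>i = 1, \<dots>, 4\<close> during the four sweeps, which go right (idle), left
  (shifting the tracks whose head moves right), right (shifting those whose head moves left) and left
  back to the centre (idle).
\<close>

definition st :: "nat \<Rightarrow> nat \<Rightarrow> nat \<Rightarrow> nat" where "st q c i = to_nat (q, c, i)"

definition target_code :: "target \<Rightarrow> target" where
  "target_code p = (case p of TSt q \<Rightarrow> TSt (st q 0 5) | _ \<Rightarrow> p)"

text \<open>Track \<open>j\<close> is tape \<open>Suc j\<close> of \<open>M\<close>. As the
  simulated heads stay at position \<open>0\<close>, a head moving right means a track moving left,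
  which a leftward sweep achieves, and conversely.\<close>

definition shift_mask :: "nat \<Rightarrow> nat \<Rightarrow> nat \<Rightarrow> nat \<Rightarrow> bool" where
  "shift_mask q c i j = (case delta M q c of (p, D, A) \<Rightarrow>
     j < w \<and> (i = 2 \<and> D ! Suc j = DRight \<or> i = 3 \<and> D ! Suc j = DLeft))"

definition sweep_dir :: "nat \<Rightarrow> dir" where "sweep_dir i = (if i = 1 \<or> i = 3 then DRight else DLeft)"
definition stop_flag :: "nat \<Rightarrow> nat" where "stop_flag i = (if i = 4 then 2 else 0)"
definition visit :: "nat \<Rightarrow> nat" where "visit f = (if f = 0 then 1 else f)"

definition sweep_act :: "nat \<Rightarrow> nat \<Rightarrow> nat \<Rightarrow> target \<times> dir list \<times> transfo" where
  "sweep_act q c i = (TSt (st q c i), [DStay, sweep_dir i], shift_op (shift_mask q c i) visit)"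

text \<open>During a sweep, \<open>r\<close> is the flag that the cell under head \<open>1\<close>
  had before the last action. The end of a sweep is thus noticed only after the end cell has been
  processed; in the first three sweeps that cell was fresh and has now joined the visited region.
  For \<open>i = 5\<close>, \<open>r\<close> is the last outcome of \<open>M\<close>; replacing
  foreign values by \<open>0\<close> keeps the set of states closed.\<close>

definition delta2 :: "nat \<Rightarrow> nat \<Rightarrow> target \<times> dir list \<times> transfo" where
  "delta2 n r = (case from_nat n of (q, c, i) \<Rightarrow>
     if i = 5 then (TSt (st q (if r \<in> calph M then r else 0) 0), [DStay, DStay], shift_op (\<lambda>_. False) (\<lambda>_. 2))
     else if i = 0 then sweep_act q c 1
     else if r \<noteq> stop_flag i then sweep_act q c i
     else if i = 4 then (case delta M q c of (p, D, A) \<Rightarrow> (target_code p, [D ! 0, DStay], lift_op A))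
     else sweep_act q c (Suc i))"

definition states2 :: "nat set" where
  "states2 = (\<lambda>(q, c, i). st q c i) ` (states M \<times> calph M \<times> {..5::nat})"

definition calph2 :: "nat set" where "calph2 = calph M \<union> {0, 1, 2}"

definition M2 :: cqtm where
  "M2 = \<lparr>states = states2, start = st (start M) 0 5, calph = calph2, qalph = alph2, ntapes = 2,
     transf = {blank_test 2 alph2 0, blank_test 2 alph2 1} \<union> (\<lambda>(n, r). snd (snd (delta2 n r))) ` (states2 \<times> calph2),
     delta = delta2\<rparr>"

lemma M2_simps [simp]:
  "states M2 = states2" "start M2 = st (start M) 0 5" "calph M2 = calph2" "qalph M2 = alph2"
  "ntapes M2 = 2" "delta M2 = delta2"
  by (simp_all add: M2_def)

section \<open>Well-formedness of the simulating machine\<close>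

lemma ntapes: "ntapes M = Suc w"
  using wf by (simp add: wf_cqtm_def w_def)

lemma finite_qalph: "finite (qalph M)" and zero_qalph: "0 \<in> qalph M"
  and finite_calph: "finite (calph M)" and zero_calph: "0 \<in> calph M"
  and finite_states: "finite (states M)" and start_states: "start M \<in> states M"
  using wf by (simp_all add: wf_cqtm_def)

lemma delta_wf:
  assumes "q \<in> states M" "c \<in> calph M" "delta M q c = (p, D, A)"
  shows "p \<in> TSt ` states M \<union> {TYes, TNo, THalt}" "length D = Suc w"
    "admissible (ntapes M) (qalph M) A" "fst A \<subseteq> calph M"
proof -
  have "\<forall>q\<in>states M. \<forall>c\<in>calph M. (case delta M q c of (p, D, A) \<Rightarrow>
      p \<in> TSt ` states M \<union> {TYes, TNo, THalt} \<and> length D = ntapes M \<and> A \<in> transf M)"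
    using wf unfolding wf_cqtm_def by (elim conjE) assumption
  then have *: "p \<in> TSt ` states M \<union> {TYes, TNo, THalt} \<and> length D = ntapes M \<and> A \<in> transf M"
    using assms by fastforce
  then show "p \<in> TSt ` states M \<union> {TYes, TNo, THalt}" "length D = Suc w"
    by (simp_all add: ntapes)
  from * show "admissible (ntapes M) (qalph M) A" "fst A \<subseteq> calph M"
    using wf unfolding wf_cqtm_def by blast+
qed

text \<open>Bare symbols are at most \<open>Max (qalph M)\<close>, and all other codes exceed
  it.\<close>

lemma code0_eq_iff:
  assumes "a \<in> qalph M" "a' \<in> qalph M"
  shows "code0 a b = code0 a' b' \<longleftrightarrow> a = a' \<and> b = b'"
proof -
  have "a \<le> Max (qalph M)" "a' \<le> Max (qalph M)"
    using assms finite_qalph by simp_all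
  then show ?thesis by (auto simp: code0_def)
qed

lemma code1_eq_iff: "code1 u f = code1 u' f' \<longleftrightarrow> u = u' \<and> f = f'"
  by (auto simp: code1_def)

lemma code0_pad [simp]: "code0 a pad = a"
  by (simp add: code0_def)

lemma code1_pad [simp]: "code1 pad 0 = 0"
  by (simp add: code1_def)

lemma pad_blocks: "pad \<in> blocks"
  using zero_qalph by (auto simp: pad_def blocks_def cells_def)

lemma blocks_length: "u \<in> blocks \<Longrightarrow> length u = w"
  by (simp add: blocks_def cells_def)

lemma blocks_nth: "u \<in> blocks \<Longrightarrow> j < w \<Longrightarrow> u ! j \<in> qalph M"
  using nth_mem by (fastforce simp: blocks_def cells_def)

lemma inj_pair_code: "inj_on pair_code quads"
  by (auto simp: inj_on_def pair_code_def quads_def code0_eq_iff code1_eq_iff)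

lemma finite_alph2: "finite alph2"
  by (simp add: alph2_def blocks_def finite_cells finite_qalph)

lemma code0_alph2: "a \<in> qalph M \<Longrightarrow> b \<in> blocks \<Longrightarrow> code0 a b \<in> alph2"
  unfolding alph2_def by (intro UnI1 image_eqI[of _ _ "(a, b)"]) auto

lemma code1_alph2: "u \<in> blocks \<Longrightarrow> f \<in> {0, 1, 2} \<Longrightarrow> code1 u f \<in> alph2"
  unfolding alph2_def by (intro UnI2 image_eqI[of _ _ "(u, f)"]) auto

lemma qalph_subset: "qalph M \<subseteq> alph2"
  using code0_alph2[OF _ pad_blocks] by auto

lemma pair_code_cells: "x \<in> quads \<Longrightarrow> pair_code x \<in> cells 2 alph2"
  by (auto simp: pair_code_def quads_def cells_def code0_alph2 code1_alph2)

lemma mix_blocks: "u \<in> blocks \<Longrightarrow> b \<in> blocks \<Longrightarrow> mix \<mu> u b \<in> blocks"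
  using blocks_nth by (auto simp: mix_def blocks_def cells_def)

lemma mix_mix: "length b = w \<Longrightarrow> length u = w \<Longrightarrow> mix \<mu> (mix \<mu> b u) (mix \<mu> u b) = b"
  by (auto simp: mix_def intro!: nth_equalityI)

lemma swap_quad_quads:
  "s ` {0, 1, 2} \<subseteq> {0, 1, 2} \<Longrightarrow> x \<in> quads \<Longrightarrow> swap_quad \<mu> s x \<in> quads"
  by (auto simp: quads_def swap_quad_def mix_blocks)

lemma swap_cells_pair_code: "x \<in> quads \<Longrightarrow> swap_cells \<mu> s (pair_code x) = pair_code (swap_quad \<mu> s x)"
  by (simp add: swap_cells_def inv_into_f_f[OF inj_pair_code])

lemma flag_of_pair_code: "x \<in> quads \<Longrightarrow> flag_of (pair_code x) = snd (snd (snd x))"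
  by (simp add: flag_of_def inv_into_f_f[OF inj_pair_code])

text \<open>Mixing the two results once more with the same mask undoes the exchange
  (\<open>mix_mix\<close>). Only the flag has to be supplied, since \<open>s\<close> may merge
  flags.\<close>

lemma swap_quad_inj:
  assumes "x \<in> quads" "y \<in> quads" "swap_quad \<mu> s x = swap_quad \<mu> s y"
    "snd (snd (snd x)) = snd (snd (snd y))"
  shows "x = y"
proof -
  obtain a b u f a' b' u' f' where x: "x = (a, b, u, f)" and y: "y = (a', b', u', f')"
    by (metis prod_cases4)
  have l: "length b = w" "length u = w" "length b' = w" "length u' = w"
    using assms(1,2) x y by (auto simp: quads_def blocks_length)
  have "mix \<mu> u b = mix \<mu> u' b'" "mix \<mu> b u = mix \<mu> b' u'" "a = a'" "f = f'"
    using assms(3,4) x y by (auto simp: swap_quad_def)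
  then show ?thesis using mix_mix l x y by metis
qed

lemma swap_cells_cells:
  assumes "s ` {0, 1, 2} \<subseteq> {0, 1, 2}" "z \<in> cells 2 alph2"
  shows "swap_cells \<mu> s z \<in> cells 2 alph2"
proof (cases "z \<in> pair_code ` quads")
  case True
  then show ?thesis
    using swap_quad_quads[OF assms(1)] pair_code_cells by (fastforce simp: swap_cells_pair_code)
qed (use assms in \<open>simp add: swap_cells_def\<close>)

lemma flag_of_range: "flag_of z \<in> {0, 1, 2}"
proof (cases "z \<in> pair_code ` quads")
  case True
  then show ?thesis by (auto simp: flag_of_pair_code quads_def)
qed (simp add: flag_of_def)

lemma swap_cells_inj:
  assumes s: "s ` {0, 1, 2} \<subseteq> {0, 1, 2}"
  shows "inj_on (\<lambda>z. (swap_cells \<mu> s z, flag_of z)) B"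
proof (rule inj_onI)
  fix z z' assume e: "(swap_cells \<mu> s z, flag_of z) = (swap_cells \<mu> s z', flag_of z')"
  \<comment> \<open>Codes are mapped to codes and all other pairs are fixed, so the two kinds cannot
    collide.\<close>
  have stays: "swap_cells \<mu> s z \<in> pair_code ` quads \<longleftrightarrow> z \<in> pair_code ` quads" for z
  proof (cases "z \<in> pair_code ` quads")
    case True
    then show ?thesis using swap_quad_quads[OF s] by (auto simp: swap_cells_pair_code)
  qed (simp add: swap_cells_def)
  show "z = z'"
  proof (cases "z \<in> pair_code ` quads")
    case True
    moreover from this have "z' \<in> pair_code ` quads"
      using stays[of z] stays[of z'] e by simp
    ultimately obtain x y where x: "x \<in> quads" "z = pair_code x" and y: "y \<in> quads" "z' = pair_code y"
      by blast
    have "swap_quad \<mu> s x = swap_quad \<mu> s y"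
      using e x y swap_quad_quads[OF s] inj_pair_code
      by (auto simp: swap_cells_pair_code inj_on_eq_iff)
    moreover have "snd (snd (snd x)) = snd (snd (snd y))"
      using e x y by (simp add: flag_of_pair_code)
    ultimately show ?thesis using swap_quad_inj x y by blast
  next
    case False
    moreover from this have "z' \<notin> pair_code ` quads"
      using stays[of z] stays[of z'] e by simp
    ultimately show ?thesis using e by (simp add: swap_cells_def)
  qed
qed

lemma shift_op_admissible:
  "s ` {0, 1, 2} \<subseteq> {0, 1, 2} \<Longrightarrow> admissible 2 alph2 (shift_op \<mu> s)"
  unfolding shift_op_def
  by (rule perm_transfo_admissible)
    (use flag_of_range in \<open>auto simp: finite_alph2 swap_cells_inj swap_cells_cells\<close>)

lemma cells_Suc_iff: "v \<in> cells (Suc w) (qalph M) \<longleftrightarrow> (\<exists>a u. v = a # u \<and> a \<in> qalph M \<and> u \<in> blocks)"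
  by (cases v) (auto simp: cells_def blocks_def)

lemma inj_merge_code: "inj_on merge_code (cells (Suc w) (qalph M) \<times> {0, 1, 2})"
  by (auto simp: inj_on_def merge_code_def code1_eq_iff cells_Suc_iff)

lemma merge_code_cells: "merge_code ` (cells (Suc w) (qalph M) \<times> {0, 1, 2}) \<subseteq> cells 2 alph2"
  by (auto simp: merge_code_def cells_Suc_iff cells_def[of 2] code1_alph2 subsetD[OF qalph_subset])

lemma lift_op_admissible:
  "admissible (ntapes M) (qalph M) A \<Longrightarrow> admissible 2 alph2 (lift_op A)"
  unfolding lift_op_def ntapes
  by (rule embed_transfo_admissible[OF _ inj_merge_code merge_code_cells finite_qalph finite_alph2]) simp_all

lemma st_states2: "q \<in> states M \<Longrightarrow> c \<in> calph M \<Longrightarrow> i \<le> 5 \<Longrightarrow> st q c i \<in> states2"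
  unfolding states2_def by (intro image_eqI[of _ _ "(q, c, i)"]) auto

lemma fst_shift_op: "fst (shift_op \<mu> s) \<subseteq> calph2"
  by (simp add: shift_op_def perm_transfo_def calph2_def)

lemma visit_range: "visit ` {0, 1, 2} \<subseteq> {0, 1, 2}"
  by (auto simp: visit_def)

lemma sweep_act_wf:
  assumes "q \<in> states M" "c \<in> calph M" "i \<le> 5" "sweep_act q c i = (p, D, A)"
  shows "p \<in> TSt ` states2" "length D = 2" "admissible 2 alph2 A" "fst A \<subseteq> calph2"
  using assms st_states2[of q c i] fst_shift_op shift_op_admissible[OF visit_range]
  by (auto simp: sweep_act_def)

lemma delta2_wf:
  assumes "n \<in> states2" "delta2 n r = (p, D, A)"
  shows "p \<in> TSt ` states2 \<union> {TYes, TNo, THalt} \<and> length D = 2 \<and> admissible 2 alph2 A \<and> fst A \<subseteq> calph2"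
proof -
  obtain q c i where q: "q \<in> states M" "c \<in> calph M" "i \<le> 5" and n: "n = st q c i"
    using assms(1) by (auto simp: states2_def)
  have fn: "from_nat n = (q, c, i)" by (simp add: n st_def)
  have e: "delta2 n r = (if i = 5 then (TSt (st q (if r \<in> calph M then r else 0) 0), [DStay, DStay], shift_op (\<lambda>_. False) (\<lambda>_. 2))
     else if i = 0 then sweep_act q c 1
     else if r \<noteq> stop_flag i then sweep_act q c i
     else if i = 4 then (case delta M q c of (p, D, A) \<Rightarrow> (target_code p, [D ! 0, DStay], lift_op A))
     else sweep_act q c (Suc i))"
    by (simp add: delta2_def fn)
  consider "i = 5" | j where "j \<le> 5" "delta2 n r = sweep_act q c j"
    | "i = 4" "delta2 n r = (case delta M q c of (p, D, A) \<Rightarrow> (target_code p, [D ! 0, DStay], lift_op A))"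
    using e q(3) by (metis Suc_leI le_neq_implies_less one_le_numeral)
  then show ?thesis
  proof cases
    case 1
    then have *: "p = TSt (st q (if r \<in> calph M then r else 0) 0)" "D = [DStay, DStay]"
      "A = shift_op (\<lambda>_. False) (\<lambda>_. 2)"
      using assms(2) e by auto
    have "st q (if r \<in> calph M then r else 0) 0 \<in> states2"
      using q zero_calph by (simp add: st_states2)
    moreover have "admissible 2 alph2 A"
      unfolding * by (rule shift_op_admissible) auto
    moreover have "fst A \<subseteq> calph2"
      unfolding * by (rule fst_shift_op)
    ultimately show ?thesis by (simp add: *)
  next
    case 2
    then have "sweep_act q c j = (p, D, A)" using assms(2) by simp
    then show ?thesis using sweep_act_wf[OF q(1,2) 2(1)] by blast
  next
    case 3
    obtain p0 D0 A0 where d: "delta M q c = (p0, D0, A0)" by (metis prod_cases3)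
    have *: "p = target_code p0" "D = [D0 ! 0, DStay]" "A = lift_op A0"
      using 3 assms(2) d by auto
    note dw = delta_wf[OF q(1,2) d]
    have "p \<in> TSt ` states2 \<union> {TYes, TNo, THalt}"
      using dw(1) zero_calph by (auto simp: * target_code_def st_states2)
    moreover have "fst A \<subseteq> calph2"
      using dw(4) by (auto simp: * lift_op_def embed_transfo_def calph2_def)
    ultimately show ?thesis using lift_op_admissible[OF dw(3)] by (simp add: *)
  qed
qed

lemma wf_M2: "wf_cqtm M2"
proof -
  have tr: "transf M2 = {blank_test 2 alph2 0, blank_test 2 alph2 1} \<union>
      (\<lambda>(n, r). snd (snd (delta2 n r))) ` (states2 \<times> calph2)"
    by (simp add: M2_def)
  have fs: "finite states2" by (simp add: states2_def finite_states finite_calph)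
  have fc: "finite calph2" by (simp add: calph2_def finite_calph)
  have bt: "fst (blank_test 2 alph2 j) \<subseteq> calph2" for j
    by (auto simp: blank_test_def calph2_def)
  have start: "st (start M) 0 5 \<in> states2"
    using start_states zero_calph by (simp add: st_states2)
  have adm: "admissible 2 alph2 A \<and> fst A \<subseteq> calph2" if A: "A \<in> transf M2" for A
  proof -
    consider j where "A = blank_test 2 alph2 j"
      | n r where "n \<in> states2" "A = snd (snd (delta2 n r))"
      using A unfolding tr by fastforce
    then show ?thesis
    proof cases
      case 1
      then show ?thesis using blank_test_admissible[OF finite_alph2] bt by simp
    next
      case 2
      then show ?thesis using delta2_wf[OF 2(1), of r] by (metis prod.collapse)
    qed
  qed
  have dl: "case delta2 n r of (p, D, A) \<Rightarrow> p \<in> TSt ` states2 \<union> {TYes, TNo, THalt} \<and> length D = 2 \<and> A \<in> transf M2"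
    if "n \<in> states2" "r \<in> calph2" for n r
  proof -
    obtain p D A where d: "delta2 n r = (p, D, A)" by (metis prod_cases3)
    have "A = (\<lambda>(n, r). snd (snd (delta2 n r))) (n, r)" by (simp add: d)
    then have "A \<in> transf M2"
      unfolding tr using that by (intro UnI2 image_eqI) auto
    then show ?thesis using delta2_wf[OF that(1) d] by (simp add: d)
  qed
  have bl: "\<forall>j<2. blank_test 2 alph2 j \<in> transf M2"
    unfolding tr by (auto simp: less_2_cases_iff)
  have "finite (transf M2)" unfolding tr using fs fc by simp
  then show ?thesis
    unfolding wf_cqtm_def M2_simps
    using adm dl bl fs fc start finite_alph2 subsetD[OF qalph_subset zero_qalph]
    by (intro conjI ballI) (simp_all add: calph2_def)
qed

section \<open>Tape contents during a sweep\<close>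

definition tab :: "(nat \<Rightarrow> nat) \<Rightarrow> nat list" where "tab b = map b [0..<w]"

text \<open>Only the cell under head \<open>0\<close> can hold a buffer, since that head rests
  during the sweeps.\<close>

definition layout :: "int \<Rightarrow> (nat \<Rightarrow> nat) \<Rightarrow> (int \<Rightarrow> nat \<Rightarrow> nat) \<Rightarrow> (int \<Rightarrow> nat) \<Rightarrow> tapes \<Rightarrow> tapes" where
  "layout h0 b U F t = (\<lambda>j p.
     if j = 0 then (if p = h0 then code0 (t 0 p) (tab b) else t 0 p)
     else if j = 1 then code1 (tab (U p)) (F p) else 0)"

definition heads :: "int \<Rightarrow> int \<Rightarrow> nat \<Rightarrow> int" where
  "heads h0 p = (\<lambda>j. if j = 0 then h0 else if j = 1 then p else 0)"

definition dir_val :: "dir \<Rightarrow> int" where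
  "dir_val d = (case d of DLeft \<Rightarrow> -1 | DRight \<Rightarrow> 1 | DStay \<Rightarrow> 0)"

text \<open>Buffer and tracks may vary with the branch \<open>t\<close>, whereas state, outcome,
  head positions and flags may not. This is what makes the measured flags predictable.\<close>

definition sim_at :: "tapes set \<Rightarrow> qstate \<Rightarrow> nat \<Rightarrow> nat \<Rightarrow> int \<Rightarrow> int \<Rightarrow> (tapes \<Rightarrow> nat \<Rightarrow> nat) \<Rightarrow>
    (tapes \<Rightarrow> int \<Rightarrow> nat \<Rightarrow> nat) \<Rightarrow> (int \<Rightarrow> nat) \<Rightarrow> config \<Rightarrow> bool" where
  "sim_at S \<phi> n r h0 p b U F C \<longleftrightarrow> (\<exists>\<phi>'. C = (TSt n, r, heads h0 p, \<phi>') \<and>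
     represents S (\<lambda>t. layout h0 (b t) (U t) F t) \<phi> \<phi>')"

definition good :: "tapes set \<Rightarrow> int \<Rightarrow> (tapes \<Rightarrow> nat \<Rightarrow> nat) \<Rightarrow> (tapes \<Rightarrow> int \<Rightarrow> nat \<Rightarrow> nat) \<Rightarrow> (int \<Rightarrow> nat) \<Rightarrow> bool" where
  "good S h0 b U F \<longleftrightarrow> (\<forall>x. F x \<in> {0, 1, 2}) \<and>
     (\<forall>t\<in>S. t 0 h0 \<in> qalph M \<and> (\<forall>j<w. b t j \<in> qalph M \<and> (\<forall>x. U t x j \<in> qalph M)))"

section \<open>Single actions and whole sweeps\<close>

lemma mix_tab: "mix \<mu> (tab u) (tab b) = tab (\<lambda>j. if \<mu> j then u j else b j)"
  by (auto simp: mix_def tab_def)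

lemma tab_blocks: "(\<And>j. j < w \<Longrightarrow> b j \<in> qalph M) \<Longrightarrow> tab b \<in> blocks"
  by (auto simp: tab_def blocks_def cells_def)

lemma upt_two: "[0..<2] = [0, 1::nat]"
  by (simp add: upt_rec)

lemma read_layout:
  "read_cells 2 (layout h0 b U F t) (heads h0 p) = pair_code (t 0 h0, tab b, tab (U p), F p)"
  by (simp add: read_cells_def upt_two layout_def heads_def pair_code_def)

lemma upd_layout:
  "upd_cells 2 (layout h0 b U F t) (heads h0 p) (pair_code (t 0 h0, tab b', tab u', f'))
    = layout h0 b' (U(p := u')) (F(p := f')) t"
  by (auto simp: upd_cells_def layout_def heads_def pair_code_def fun_eq_iff less_2_cases_iff)

lemma move_two: "move 2 [d, e] (heads h0 p) = heads (h0 + dir_val d) (p + dir_val e)"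
  by (auto simp: move_def heads_def dir_val_def fun_eq_iff less_2_cases_iff split: dir.splits)

text \<open>The flag \<open>F p'\<close> is common to all branches, so measuring it has a certain
  outcome, and the action reduces to a relabelling by
  \<open>perm_transfo_represents\<close>.\<close>

lemma micro_step:
  assumes at: "sim_at S \<phi> n r h0 p b U F C" and d: "delta2 n r = (TSt n', [DStay, e], shift_op \<mu> s)"
    and p': "p' = p + dir_val e" and good: "good S h0 b U F" and s: "s ` {0, 1, 2} \<subseteq> {0, 1, 2}"
  shows "\<exists>C'. forced M2 C [F p'] C' \<and> sim_at S \<phi> n' (F p') h0 p'
      (\<lambda>t j. if \<mu> j then U t p' j else b t j)
      (\<lambda>t. (U t)(p' := \<lambda>j. if \<mu> j then b t j else U t p' j)) (F(p' := s (F p'))) C'"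
proof -
  obtain \<phi>' where C: "C = (TSt n, r, heads h0 p, \<phi>')"
    and r: "represents S (\<lambda>t. layout h0 (b t) (U t) F t) \<phi> \<phi>'"
    using at by (auto simp: sim_at_def)
  define op where "op c = snd (perm_transfo 2 alph2 {0, 1, 2} (swap_cells \<mu> s) flag_of) c" for c
  have step: "step M2 n C c = (TSt n', c, heads h0 p', apply_op 2 alph2 (op c) (heads h0 p') \<phi>')" for c
    using p' by (simp add: C step_def d shift_op_def op_def move_two Let_def) (simp add: dir_val_def)
  have quad: "(t 0 h0, tab (b t), tab (U t p'), F p') \<in> quads" if "t \<in> S" for t
    using good that by (auto simp: quads_def good_def intro!: tab_blocks)
  have rd: "read_cells 2 (layout h0 (b t) (U t) F t) (heads h0 p') \<in> cells 2 alph2"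
    and fl: "flag_of (read_cells 2 (layout h0 (b t) (U t) F t) (heads h0 p')) = F p'" if "t \<in> S" for t
    using quad[OF that] by (simp_all add: read_layout pair_code_cells flag_of_pair_code)
  have F: "F p' \<in> {0, 1, 2}" using good by (simp add: good_def)
  note pr = perm_transfo_represents[OF finite_alph2 swap_cells_cells[OF s] swap_cells_inj[OF s] r rd fl F]
  have "represents S (\<lambda>t. layout h0 (\<lambda>j. if \<mu> j then U t p' j else b t j)
      ((U t)(p' := \<lambda>j. if \<mu> j then b t j else U t p' j)) (F(p' := s (F p'))) t) \<phi>
      (apply_op 2 alph2 (op (F p')) (heads h0 p') \<phi>')"
    unfolding op_def
    by (rule represents_cong[OF pr(1)])
      (simp_all add: read_layout swap_cells_pair_code quad swap_quad_def mix_tab upd_layout)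
  then have "sim_at S \<phi> n' (F p') h0 p'
      (\<lambda>t j. if \<mu> j then U t p' j else b t j)
      (\<lambda>t. (U t)(p' := \<lambda>j. if \<mu> j then b t j else U t p' j)) (F(p' := s (F p')))
      (step M2 n C (F p'))"
    by (auto simp: sim_at_def step)
  moreover have "forced M2 C [F p'] (step M2 n C (F p'))"
    unfolding C
  proof (rule forced_single)
    fix c assume "c \<noteq> F p'"
    then have "apply_op 2 alph2 (op c) (heads h0 p') \<phi>' = (\<lambda>t. 0)"
      unfolding op_def by (intro pr(2)) auto
    then show "\<exists>p' c' h'. step M2 n (TSt n, r, heads h0 p, \<phi>') c = (p', c', h', \<lambda>t. 0)"
      using step[of c] by (simp add: C)
  qed
  ultimately show ?thesis by blast
qed

text \<open>An action moves before it measures, so the trace starts at \<open>p + s\<close>. A sweep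
  meets each cell once, hence the flags from before the sweep are the ones recorded.\<close>

definition flag_trace :: "(int \<Rightarrow> nat) \<Rightarrow> int \<Rightarrow> int \<Rightarrow> nat \<Rightarrow> nat list" where
  "flag_trace F p s N = map (\<lambda>l. F (p + int (Suc l) * s)) [0..<N]"

lemma delta2_sweep:
  assumes "i \<in> {1..4}" "r \<noteq> stop_flag i"
  shows "delta2 (st q c i) r = sweep_act q c i"
  using assms by (auto simp: delta2_def st_def)

text \<open>On the masked tracks the buffer always holds the original symbol of the current cell; it
  is deposited in the next cell, whose symbol is picked up in exchange. Since \<open>s\<close> is
  \<open>1\<close> or \<open>-1\<close>, \<open>(x - p) * s\<close> is the distance from
  \<open>p\<close> in the direction of the sweep.\<close>

lemma sweep:
  assumes at: "sim_at S \<phi> n r h0 p b U F C" and d: "delta2 n r = sweep_act q c i" and i: "i \<in> {1..4}"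
    and s: "s = dir_val (sweep_dir i)" and good: "good S h0 b U F"
    and start: "\<And>t j. t \<in> S \<Longrightarrow> shift_mask q c i j \<Longrightarrow> b t j = U t p j"
    and N: "N \<ge> 1" and run: "\<And>l. 0 < l \<Longrightarrow> l < N \<Longrightarrow> F (p + int l * s) \<noteq> stop_flag i"
  shows "\<exists>C'. forced M2 C (flag_trace F p s N) C' \<and>
    sim_at S \<phi> (st q c i) (F (p + int N * s)) h0 (p + int N * s)
      (\<lambda>t j. if shift_mask q c i j then U t (p + int N * s) j else b t j)
      (\<lambda>t x j. if shift_mask q c i j \<and> 0 < (x - p) * s \<and> (x - p) * s \<le> int N then U t (x - s) j else U t x j)
      (\<lambda>x. if 0 < (x - p) * s \<and> (x - p) * s \<le> int N then visit (F x) else F x) C'"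
  using N run
proof (induction N rule: nat_induct_at_least)
  case base
  have s1: "s = 1 \<or> s = -1" by (auto simp: s sweep_dir_def dir_val_def)
  have near: "0 < (x - p) * s \<and> (x - p) * s \<le> 1 \<longleftrightarrow> x = p + s" for x
    using s1 by auto
  obtain C' where f: "forced M2 C [F (p + s)] C'" and a: "sim_at S \<phi> (st q c i) (F (p + s)) h0 (p + s)
      (\<lambda>t j. if shift_mask q c i j then U t (p + s) j else b t j)
      (\<lambda>t. (U t)(p + s := \<lambda>j. if shift_mask q c i j then b t j else U t (p + s) j)) (F(p + s := visit (F (p + s)))) C'"
    using micro_step[OF at d[unfolded sweep_act_def] refl good visit_range] unfolding s by blast
  \<comment> \<open>By \<open>start\<close>, the buffer deposited in the first cell is the symbol of
    \<open>p\<close>, that is, of \<open>x - s\<close>.\<close>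
  have lay: "layout h0 b' ((U t)(p + s := \<lambda>j. if shift_mask q c i j then b t j else U t (p + s) j)) (F(p + s := visit (F (p + s)))) t
      = layout h0 b' (\<lambda>x j. if shift_mask q c i j \<and> x = p + s then U t (x - s) j else U t x j)
      (\<lambda>x. if x = p + s then visit (F x) else F x) t" if "t \<in> S" for t b'
    using start[OF that] by (intro arg_cong3[where f = "\<lambda>U F. layout h0 b' U F"] ext) auto
  have "sim_at S \<phi> (st q c i) (F (p + s)) h0 (p + s)
      (\<lambda>t j. if shift_mask q c i j then U t (p + s) j else b t j)
      (\<lambda>t x j. if shift_mask q c i j \<and> x = p + s then U t (x - s) j else U t x j)
      (\<lambda>x. if x = p + s then visit (F x) else F x) C'"
    using a unfolding sim_at_def by (auto elim!: represents_cong simp: lay)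
  then show ?case using f unfolding of_nat_1 mult_1 near
    by (intro exI[of _ C']) (simp add: flag_trace_def)
next
  case (Suc N)
  have s1: "s = 1 \<or> s = -1" by (auto simp: s sweep_dir_def dir_val_def)
  let ?p = "p + int N * s"
  let ?b = "\<lambda>t j. if shift_mask q c i j then U t ?p j else b t j"
  let ?U = "\<lambda>t x j. if shift_mask q c i j \<and> 0 < (x - p) * s \<and> (x - p) * s \<le> int N then U t (x - s) j else U t x j"
  let ?F = "\<lambda>x. if 0 < (x - p) * s \<and> (x - p) * s \<le> int N then visit (F x) else F x"
  let ?q = "p + int (Suc N) * s"
  obtain C1 where f1: "forced M2 C (flag_trace F p s N) C1"
    and a1: "sim_at S \<phi> (st q c i) (F ?p) h0 ?p ?b ?U ?F C1"
    using Suc by auto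
  have good1: "good S h0 ?b ?U ?F"
  proof -
    have "?F x \<in> {0, 1, 2}" for x
    proof -
      have "F x \<in> {0, 1, 2}" using good unfolding good_def by blast
      then show ?thesis by (auto simp: visit_def)
    qed
    then show ?thesis using good unfolding good_def by (intro conjI) (blast, simp)
  qed
  have d1: "delta2 (st q c i) (F ?p) = sweep_act q c i"
    using Suc.prems[of N] Suc.hyps by (intro delta2_sweep i) auto
  have q: "?q = ?p + s" by (simp add: algebra_simps)
  \<comment> \<open>The next cell has not been met in this sweep, so its flag and tracks are still
    the original ones.\<close>
  have fresh: "\<not> (0 < (?q - p) * s \<and> (?q - p) * s \<le> int N)"
    using s1 by auto
  have near: "0 < (x - p) * s \<and> (x - p) * s \<le> int (Suc N) \<longleftrightarrow>
      0 < (x - p) * s \<and> (x - p) * s \<le> int N \<or> x = ?q" for x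
    using s1 by auto
  have Fq: "?F ?q = F ?q" by (simp only: fresh if_False)
  have Uq: "?U t ?q j = U t ?q j" for t j by (simp only: fresh simp_thms if_False)
  have qd: "?q = ?p + dir_val (sweep_dir i)" using q s by simp
  have "\<exists>C'. forced M2 C1 [F ?q] C' \<and> sim_at S \<phi> (st q c i) (F ?q) h0 ?q
      (\<lambda>t j. if shift_mask q c i j then U t ?q j else ?b t j)
      (\<lambda>t. (?U t)(?q := \<lambda>j. if shift_mask q c i j then ?b t j else U t ?q j)) (?F(?q := visit (F ?q))) C'"
    using micro_step[OF a1 d1[unfolded sweep_act_def] qd good1 visit_range]
    by (simp only: Fq Uq)
  then obtain C' where f: "forced M2 C1 [F ?q] C'" and a: "sim_at S \<phi> (st q c i) (F ?q) h0 ?q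
      (\<lambda>t j. if shift_mask q c i j then U t ?q j else ?b t j)
      (\<lambda>t. (?U t)(?q := \<lambda>j. if shift_mask q c i j then ?b t j else U t ?q j)) (?F(?q := visit (F ?q))) C'"
    by (elim exE conjE)
  have lay: "layout h0 (\<lambda>j. if shift_mask q c i j then U t ?q j else ?b t j)
        ((?U t)(?q := \<lambda>j. if shift_mask q c i j then ?b t j else U t ?q j)) (?F(?q := visit (F ?q))) t
      = layout h0 (\<lambda>j. if shift_mask q c i j then U t ?q j else b t j)
        (\<lambda>x j. if shift_mask q c i j \<and> 0 < (x - p) * s \<and> (x - p) * s \<le> int (Suc N) then U t (x - s) j else U t x j)
        (\<lambda>x. if 0 < (x - p) * s \<and> (x - p) * s \<le> int (Suc N) then visit (F x) else F x) t" for t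
  proof -
    have e: "?q - s = ?p" by (simp add: algebra_simps)
    have "(?U t)(?q := \<lambda>j. if shift_mask q c i j then ?b t j else U t ?q j)
      = (\<lambda>x j. if shift_mask q c i j \<and> 0 < (x - p) * s \<and> (x - p) * s \<le> int (Suc N) then U t (x - s) j else U t x j)"
    proof (intro ext)
      fix x j
      show "((?U t)(?q := \<lambda>j. if shift_mask q c i j then ?b t j else U t ?q j)) x j
        = (if shift_mask q c i j \<and> 0 < (x - p) * s \<and> (x - p) * s \<le> int (Suc N) then U t (x - s) j else U t x j)"
      proof (cases "x = ?q")
        case True
        show ?thesis
          unfolding near True
          by (cases "shift_mask q c i j") (simp_all only: e fun_upd_same simp_thms if_True if_False)
      next
        case False
        show ?thesis
          unfolding near by (simp only: fun_upd_other[OF False] False simp_thms)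
      qed
    qed
    moreover have "?F(?q := visit (F ?q))
      = (\<lambda>x. if 0 < (x - p) * s \<and> (x - p) * s \<le> int (Suc N) then visit (F x) else F x)"
      unfolding near by (intro ext) (auto simp del: of_nat_Suc)
    moreover have "(\<lambda>j. if shift_mask q c i j then U t ?q j else ?b t j) = (\<lambda>j. if shift_mask q c i j then U t ?q j else b t j)"
      by (intro ext) simp
    ultimately show ?thesis by (simp only:)
  qed
  have "forced M2 C (flag_trace F p s (Suc N)) C'"
    using forced_append[OF f1 f] by (simp add: flag_trace_def)
  then show ?case using a unfolding sim_at_def lay by blast
qed


section \<open>Simulating one step\<close>

lemma sim_at_cong:
  assumes "sim_at S \<phi> n r h0 p b U F C" "n' = n" "r' = r" "p' = p"
    "\<And>t j. t \<in> S \<Longrightarrow> j < w \<Longrightarrow> b t j = b' t j"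
    "\<And>t x j. t \<in> S \<Longrightarrow> j < w \<Longrightarrow> U t x j = U' t x j" "\<And>x. F x = F' x"
  shows "sim_at S \<phi> n' r' h0 p' b' U' F' C"
proof -
  have "layout h0 (b t) (U t) F t = layout h0 (b' t) (U' t) F' t" if "t \<in> S" for t
  proof -
    have "tab (b t) = tab (b' t)" "tab (U t x) = tab (U' t x)" for x
      using assms(5,6) that by (auto simp: tab_def)
    then show ?thesis using assms(7) by (auto simp: layout_def fun_eq_iff)
  qed
  then show ?thesis
    using assms(1-4) unfolding sim_at_def by (auto elim!: represents_cong)
qed

text \<open>Blank symbols at both ends make the displacement lossless: no symbol is duplicated at
  \<open>p\<close>, and the buffer is blank again at \<open>p'\<close>. The parameters
  \<open>U'\<close> and \<open>F'\<close> let each sweep state its result in closed form.\<close>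

lemma sweep_blank_buffer:
  assumes at: "sim_at S \<phi> n r h0 p (\<lambda>_ _. 0) U F C" and d: "delta2 n r = sweep_act q c i" and i: "i \<in> {1..4}"
    and s: "s = dir_val (sweep_dir i)" and good: "good S h0 (\<lambda>_ _. 0) U F"
    and N: "N \<ge> 1" and p': "p' = p + int N * s" and r': "F p' = r'"
    and run: "\<And>l. 0 < l \<Longrightarrow> l < N \<Longrightarrow> F (p + int l * s) \<noteq> stop_flag i"
    and ends: "\<And>t j. t \<in> S \<Longrightarrow> shift_mask q c i j \<Longrightarrow> U t p j = 0 \<and> U t p' j = 0"
    and U': "\<And>t x j. t \<in> S \<Longrightarrow> j < w \<Longrightarrow> U' t x j =
      (if shift_mask q c i j \<and> 0 < (x - p) * s \<and> (x - p) * s \<le> int N then U t (x - s) j else U t x j)"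
    and F': "\<And>x. F' x = (if 0 < (x - p) * s \<and> (x - p) * s \<le> int N then visit (F x) else F x)"
  shows "\<exists>C'. forced M2 C (flag_trace F p s N) C' \<and> sim_at S \<phi> (st q c i) r' h0 p' (\<lambda>_ _. 0) U' F' C'"
proof -
  have "0 = U t p j" if "t \<in> S" "shift_mask q c i j" for t j
    using ends[OF that] by simp
  from sweep[OF at d i s good this N run] obtain C' where f: "forced M2 C (flag_trace F p s N) C'"
    and a: "sim_at S \<phi> (st q c i) (F (p + int N * s)) h0 (p + int N * s)
      (\<lambda>t j. if shift_mask q c i j then U t (p + int N * s) j else 0)
      (\<lambda>t x j. if shift_mask q c i j \<and> 0 < (x - p) * s \<and> (x - p) * s \<le> int N then U t (x - s) j else U t x j)
      (\<lambda>x. if 0 < (x - p) * s \<and> (x - p) * s \<le> int N then visit (F x) else F x) C'"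
    by blast
  have "sim_at S \<phi> (st q c i) r' h0 p' (\<lambda>_ _. 0) U' F' C'"
    by (rule sim_at_cong[OF a]) (use p' r' ends U' F' in auto)
  then show ?thesis using f by blast
qed

section \<open>The schedule of sweeps and the encoding of tapes\<close>

definition flags :: "int \<Rightarrow> int \<Rightarrow> int \<Rightarrow> nat" where
  "flags l r x = (if x = 0 then 2 else if - l \<le> x \<and> x \<le> r then 1 else 0)"

text \<open>Each simulated step visits one new cell on the left and, by its two rightward sweeps,
  two on the right. For \<open>m = 0\<close> the centre is not yet marked.\<close>

definition flags_at :: "nat \<Rightarrow> int \<Rightarrow> nat" where
  "flags_at m = (if m = 0 then (\<lambda>_. 0) else flags (int m) (2 * int m))"

text \<open>With the cells from \<open>-m\<close> to \<open>2m\<close> visited, the turning points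
  are \<open>2m + 1\<close>, \<open>-(m + 1)\<close> and \<open>2m + 2\<close>, each the nearest
  fresh cell in its direction. Each trace is read off the flags left by the preceding sweep.\<close>

definition prelude :: "nat \<Rightarrow> nat list" where
  "prelude m = [flags_at m 0] @ flag_trace (flags (int m) (2 * int m)) 0 1 (2 * m + 1)
     @ flag_trace (flags (int m) (2 * int m + 1)) (2 * int m + 1) (-1) (3 * m + 2)
     @ flag_trace (flags (int m + 1) (2 * int m + 1)) (- (int m + 1)) 1 (3 * m + 3)
     @ flag_trace (flags (int m + 1) (2 * int m + 2)) (2 * int m + 2) (-1) (2 * m + 2)"

text \<open>The extent of tape \<open>0\<close> is not bounded. By the strict inequality,
  \<open>m = 0\<close> makes the other tapes blank, as at the start, while \<open>m > 0\<close>
  admits any symbol under the head.\<close>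

definition tapes_within :: "(nat \<Rightarrow> int) \<Rightarrow> nat \<Rightarrow> tapes set" where
  "tapes_within h m = {t. (\<forall>j p. t j p \<in> qalph M) \<and> (\<forall>j p. w < j \<longrightarrow> t j p = 0) \<and>
     (\<forall>j p. 0 < j \<and> j \<le> w \<and> t j p \<noteq> 0 \<longrightarrow> \<bar>p - h j\<bar> < int m)}"

definition view :: "(nat \<Rightarrow> int) \<Rightarrow> tapes \<Rightarrow> int \<Rightarrow> nat \<Rightarrow> nat" where
  "view h t x j = t (Suc j) (h (Suc j) + x)"

text \<open>With a blank buffer its position is immaterial (\<open>layout_blank_buffer\<close>);
  \<open>0\<close> is a placeholder.\<close>

definition enc :: "(nat \<Rightarrow> int) \<Rightarrow> nat \<Rightarrow> tapes \<Rightarrow> tapes" where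
  "enc h m t = layout 0 (\<lambda>_. 0) (view h t) (flags_at m) t"

lemma length_prelude: "length (prelude m) = 10 * m + 9"
  by (simp add: prelude_def flag_trace_def)

lemma flags_range: "flags l r x \<in> {0, 1, 2}"
  by (simp add: flags_def)

lemma flags_at_range: "flags_at m x \<in> {0, 1, 2}"
  using flags_range by (simp add: flags_at_def)

lemma set_flag_trace: "(\<And>x. F x \<in> B) \<Longrightarrow> set (flag_trace F p s N) \<subseteq> B"
  by (auto simp: flag_trace_def)

lemma set_prelude: "set (prelude m) \<subseteq> {0, 1, 2}"
  unfolding prelude_def set_append using flags_at_range[of m 0]
  by (intro Un_least set_flag_trace flags_range) simp

lemma tab_zero [simp]: "tab (\<lambda>_. 0) = pad"
  by (simp add: tab_def pad_def map_replicate_const)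

lemma tab_eq_iff: "tab b = tab b' \<longleftrightarrow> (\<forall>j<w. b j = b' j)"
  by (auto simp: tab_def)

lemma layout_blank_buffer: "layout h0 (\<lambda>_. 0) U F t = layout 0 (\<lambda>_. 0) U F t"
  by (auto simp: layout_def fun_eq_iff)

lemma enc_apply:
  "enc h m t = (\<lambda>j p. if j = 0 then t 0 p else if j = 1 then code1 (tab (view h t p)) (flags_at m p) else 0)"
  by (auto simp: enc_def layout_def fun_eq_iff)

text \<open>Both tapes are viewed from the same heads \<open>h\<close>, so the tracks determine the
  tapes of \<open>M\<close> other than tape \<open>0\<close>, and conversely. This yields the
  injectivity of \<open>enc\<close> and the condition on the environment in
  \<open>represents_tape1_rho\<close>.\<close>

lemma enc_others:
  assumes "t \<in> tapes_within h m" "t' \<in> tapes_within h m"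
  shows "(\<forall>j. j \<noteq> 0 \<longrightarrow> enc h n t j = enc h n t' j) \<longleftrightarrow> (\<forall>j. j \<noteq> 0 \<longrightarrow> t j = t' j)"
proof
  assume "\<forall>j. j \<noteq> 0 \<longrightarrow> enc h n t j = enc h n t' j"
  then have "enc h n t 1 = enc h n t' 1" by simp
  then have "view h t p j = view h t' p j" if "j < w" for p j
    using that by (auto simp: enc_apply fun_eq_iff code1_eq_iff tab_eq_iff)
  then have *: "t (Suc j) p = t' (Suc j) p" if "j < w" for p j
    using that by (simp add: view_def) (metis add_diff_cancel_left' diff_add_cancel add.commute)
  show "\<forall>j. j \<noteq> 0 \<longrightarrow> t j = t' j"
  proof (intro allI impI ext)
    fix j :: nat and p assume "j \<noteq> 0"
    show "t j p = t' j p"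
    proof (cases "j \<le> w")
      case True
      with \<open>j \<noteq> 0\<close> show ?thesis using *[of "j - 1" p] by simp
    next
      case False
      then show ?thesis using assms by (simp add: tapes_within_def)
    qed
  qed
next
  assume *: "\<forall>j. j \<noteq> 0 \<longrightarrow> t j = t' j"
  then have "tab (view h t p) = tab (view h t' p)" for p by (simp add: tab_def view_def)
  then show "\<forall>j. j \<noteq> 0 \<longrightarrow> enc h n t j = enc h n t' j" by (simp add: enc_apply fun_eq_iff)
qed

lemma enc_tape0: "enc h n t 0 = t 0"
  by (simp add: enc_apply)

lemma inj_enc: "inj_on (enc h n) (tapes_within h m)"
proof (rule inj_onI)
  fix t t' assume t: "t \<in> tapes_within h m" "t' \<in> tapes_within h m" and e: "enc h n t = enc h n t'"
  have "t j = t' j" for j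
  proof (cases "j = 0")
    case True
    then show ?thesis using e enc_tape0 by metis
  next
    case False
    then show ?thesis using enc_others[OF t, of n, THEN iffD1] e by simp
  qed
  then show "t = t'" by (rule ext)
qed

definition moved :: "dir list \<Rightarrow> (nat \<Rightarrow> int) \<Rightarrow> nat \<Rightarrow> int" where
  "moved D h = move (ntapes M) D h"

lemma moved_apply: "j \<le> w \<Longrightarrow> moved D h j = h j + dir_val (D ! j)"
  by (simp add: moved_def move_def ntapes dir_val_def)

lemma tapes_within_moved: "tapes_within h m \<subseteq> tapes_within (moved D h) (Suc m)"
proof
  fix t assume t: "t \<in> tapes_within h m"
  have "\<bar>p - moved D h j\<bar> < int (Suc m)" if "0 < j" "j \<le> w" "t j p \<noteq> 0" for j p
  proof -
    have "\<bar>p - h j\<bar> < int m" using t that by (auto simp: tapes_within_def)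
    moreover have "\<bar>dir_val (D ! j)\<bar> \<le> 1" by (auto simp: dir_val_def split: dir.split)
    ultimately show ?thesis by (simp add: moved_apply that)
  qed
  then show "t \<in> tapes_within (moved D h) (Suc m)"
    using t by (auto simp: tapes_within_def)
qed

lemma view_blank:
  assumes "t \<in> tapes_within h m" "j < w" "int m \<le> \<bar>x\<bar>"
  shows "view h t x j = 0"
proof (rule ccontr)
  assume "view h t x j \<noteq> 0"
  then have "\<bar>(h (Suc j) + x) - h (Suc j)\<bar> < int m"
    using assms(1,2) unfolding tapes_within_def view_def by (auto dest!: spec[of _ "Suc j"])
  then show False using assms(3) by simp
qed

lemma delta2_start: "delta2 (st q 0 5) c = (TSt (st q (if c \<in> calph M then c else 0) 0), [DStay, DStay], shift_op (\<lambda>_. False) (\<lambda>_. 2))"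
  by (simp add: delta2_def st_def)

lemma delta2_first: "delta2 (st q c 0) r = sweep_act q c 1"
  by (simp add: delta2_def st_def)

lemma delta2_next: "i \<in> {1..3} \<Longrightarrow> delta2 (st q c i) 0 = sweep_act q c (Suc i)"
  by (auto simp: delta2_def st_def stop_flag_def)

text \<open>The prelude displaces the tracks until they agree with the view from the moved heads.
  Head \<open>0\<close> itself moves only with the action that applies the transformation. Nothing
  is written on the tapes of \<open>M\<close>, so the old bound on \<open>t\<close>
  persists.\<close>

lemma shifting_phase:
  assumes sim: "represents (tapes_within h m) (enc h m) \<phi> \<phi>'" and q: "q \<in> states M" "c \<in> calph M"
    and d: "delta M q c = (p, D, A)"
  shows "\<exists>\<phi>1. forced M2 (TSt (st q 0 5), c, heads (h 0) 0, \<phi>') (prelude m) (TSt (st q c 4), 2, heads (h 0) 0, \<phi>1)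
    \<and> represents (tapes_within h m) (enc (moved D h) (Suc m)) \<phi> \<phi>1"
proof -
  let ?S = "tapes_within h m" and ?Z = "\<lambda>_ _. 0::nat" and ?m = "int m" and ?n0 = "h 0"
  let ?F0 = "flags ?m (2 * ?m)" and ?F1 = "flags ?m (2 * ?m + 1)"
  let ?F2 = "flags (?m + 1) (2 * ?m + 1)" and ?F3 = "flags (?m + 1) (2 * ?m + 2)"
  let ?U0 = "view h" and ?U3 = "view (moved D h)"
  \<comment> \<open>The contents between the two shifting sweeps: only the tracks of right-moving
    heads have been displaced.\<close>
  let ?U2 = "\<lambda>t x j. if D ! Suc j = DRight then view h t (x + 1) j else view h t x j"
  have sym: "t j x \<in> qalph M" if "t \<in> ?S" for t j x using that by (simp add: tapes_within_def)
  have good0: "good ?S ?n0 ?Z ?U0 F" and good3: "good ?S ?n0 ?Z ?U3 F" and good2: "good ?S ?n0 ?Z ?U2 F"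
    if "\<And>x. F x \<in> {0, 1, 2}" for F
    using that sym zero_qalph by (simp_all add: good_def view_def del: insert_iff)
  note good0 = good0[of "flags l r" for l r, OF flags_range]
    and good2 = good2[of "flags l r" for l r, OF flags_range]
    and good3 = good3[of "flags l r" for l r, OF flags_range]
    and good_start = good0[of "flags_at m", OF flags_at_range]
  have step_acts: "delta2 (st q c 1) 0 = sweep_act q c 2" "delta2 (st q c 2) 0 = sweep_act q c 3"
    "delta2 (st q c 3) 0 = sweep_act q c 4"
    using delta2_next[of 1 q c] delta2_next[of 2 q c] delta2_next[of 3 q c] by (simp_all add: numeral_eq_Suc)
  have mask: "shift_mask q c i j \<longleftrightarrow> j < w \<and> (i = 2 \<and> D ! Suc j = DRight \<or> i = 3 \<and> D ! Suc j = DLeft)" for i j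
    by (simp add: shift_mask_def d)
  have "sim_at ?S \<phi> (st q 0 5) c ?n0 0 ?Z ?U0 (flags_at m) (TSt (st q 0 5), c, heads ?n0 0, \<phi>')"
    using sim unfolding sim_at_def enc_def by (subst layout_blank_buffer) simp
  from micro_step[OF this _ _ good_start, of "st q c 0" DStay "\<lambda>_. False" "\<lambda>_. 2" 0]
  obtain C1 where f1: "forced M2 (TSt (st q 0 5), c, heads ?n0 0, \<phi>') [flags_at m 0] C1"
    and a1: "sim_at ?S \<phi> (st q c 0) (flags_at m 0) ?n0 0 ?Z (\<lambda>t. (?U0 t)(0 := \<lambda>j. ?U0 t 0 j)) ((flags_at m)(0 := 2)) C1"
    using q by (auto simp: delta2_start dir_val_def)
  \<comment> \<open>For \<open>m = 0\<close> the action has just created the centre; otherwise it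
    has overwritten the flag \<open>2\<close> by itself.\<close>
  have a1: "sim_at ?S \<phi> (st q c 0) (flags_at m 0) ?n0 0 ?Z ?U0 ?F0 C1"
    by (rule sim_at_cong[OF a1]) (auto simp: flags_at_def flags_def)
  have "\<exists>C'. forced M2 C1 (flag_trace ?F0 0 1 (2 * m + 1)) C' \<and>
      sim_at ?S \<phi> (st q c 1) 0 ?n0 (2 * ?m + 1) ?Z ?U0 ?F1 C'"
    by (rule sweep_blank_buffer[OF a1 delta2_first _ _ good0])
      (auto simp: sweep_dir_def dir_val_def mask flags_def stop_flag_def visit_def)
  then obtain C2 where f2: "forced M2 C1 (flag_trace ?F0 0 1 (2 * m + 1)) C2"
    and a2: "sim_at ?S \<phi> (st q c 1) 0 ?n0 (2 * ?m + 1) ?Z ?U0 ?F1 C2" by blast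
  \<comment> \<open>Both turning points lie at distance at least \<open>m\<close> from the centre,
    where all tracks are blank (\<open>view_blank\<close>).\<close>
  have "\<exists>C'. forced M2 C2 (flag_trace ?F1 (2 * ?m + 1) (-1) (3 * m + 2)) C' \<and>
      sim_at ?S \<phi> (st q c 2) 0 ?n0 (- (?m + 1)) ?Z ?U2 ?F2 C'"
    by (rule sweep_blank_buffer[OF a2 step_acts(1) _ _ good0])
      (auto simp: sweep_dir_def dir_val_def mask flags_def stop_flag_def visit_def view_blank)
  then obtain C3 where f3: "forced M2 C2 (flag_trace ?F1 (2 * ?m + 1) (-1) (3 * m + 2)) C3"
    and a3: "sim_at ?S \<phi> (st q c 2) 0 ?n0 (- (?m + 1)) ?Z ?U2 ?F2 C3" by blast
  have U3: "?U3 t x j = (case D ! Suc j of DRight \<Rightarrow> view h t (x + 1) j | DLeft \<Rightarrow> view h t (x - 1) j | DStay \<Rightarrow> view h t x j)"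
    if "j < w" for t x j
    using that by (auto simp: view_def moved_apply dir_val_def algebra_simps split: dir.split)
  have "\<exists>C'. forced M2 C3 (flag_trace ?F2 (- (?m + 1)) 1 (3 * m + 3)) C' \<and>
      sim_at ?S \<phi> (st q c 3) 0 ?n0 (2 * ?m + 2) ?Z ?U3 ?F3 C'"
    by (rule sweep_blank_buffer[OF a3 step_acts(2) _ _ good2])
      (auto simp: sweep_dir_def dir_val_def mask flags_def stop_flag_def visit_def view_blank U3 split: dir.split)
  then obtain C4 where f4: "forced M2 C3 (flag_trace ?F2 (- (?m + 1)) 1 (3 * m + 3)) C4"
    and a4: "sim_at ?S \<phi> (st q c 3) 0 ?n0 (2 * ?m + 2) ?Z ?U3 ?F3 C4" by blast
  \<comment> \<open>All cells on the way back are already visited, so the flags no longer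
    change.\<close>
  have "\<exists>C'. forced M2 C4 (flag_trace ?F3 (2 * ?m + 2) (-1) (2 * m + 2)) C' \<and>
      sim_at ?S \<phi> (st q c 4) 2 ?n0 0 ?Z ?U3 ?F3 C'"
    by (rule sweep_blank_buffer[OF a4 step_acts(3) _ _ good3])
      (auto simp: sweep_dir_def dir_val_def mask flags_def stop_flag_def visit_def)
  then obtain C5 where f5: "forced M2 C4 (flag_trace ?F3 (2 * ?m + 2) (-1) (2 * m + 2)) C5"
    and a5: "sim_at ?S \<phi> (st q c 4) 2 ?n0 0 ?Z ?U3 ?F3 C5" by blast
  have F3: "flags_at (Suc m) = ?F3" by (simp add: flags_at_def algebra_simps)
  have lay: "layout ?n0 (\<lambda>_. 0) (?U3 t) ?F3 t = enc (moved D h) (Suc m) t" for t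
    unfolding enc_def F3 by (rule layout_blank_buffer)
  from a5 obtain \<phi>1 where "C5 = (TSt (st q c 4), 2, heads ?n0 0, \<phi>1)"
    "represents ?S (enc (moved D h) (Suc m)) \<phi> \<phi>1"
    unfolding sim_at_def lay by (elim exE conjE)
  moreover have "forced M2 (TSt (st q 0 5), c, heads ?n0 0, \<phi>') (prelude m) C5"
    unfolding prelude_def by (rule forced_append[OF f1 forced_append[OF f2 forced_append[OF f3 forced_append[OF f4 f5]]]])
  ultimately show ?thesis by blast
qed

section \<open>A transformation of \<open>M\<close> on two cells\<close>

lemma read_cells_Suc: "read_cells (Suc w) t h = t 0 (h 0) # tab (\<lambda>j. t (Suc j) (h (Suc j)))"
  by (simp add: read_cells_def tab_def map_upt_Suc del: upt_Suc)

text \<open>The condition \<open>0 < n\<close> means that the centre has been marked, which fixes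
  the flag to \<open>2\<close>.\<close>

lemma read_enc:
  "0 < n \<Longrightarrow> read_cells 2 (enc h n t) (heads (h 0) 0) = merge_code (read_cells (Suc w) t h, 2)"
  by (simp add: read_cells_def[of 2] upt_two enc_apply heads_def read_cells_Suc merge_code_def
      view_def[abs_def] tab_def flags_at_def flags_def)

lemma upd_enc:
  assumes "0 < n" "ys \<in> cells (Suc w) (qalph M)"
  shows "upd_cells 2 (enc h n t) (heads (h 0) 0) (merge_code (ys, 2)) = enc h n (upd_cells (Suc w) t h ys)"
proof -
  obtain a u where ys: "ys = a # u" "length u = w"
    using assms(2) by (auto simp: cells_Suc_iff blocks_length)
  have "tab (view h (upd_cells (Suc w) t h ys) p) = (if p = 0 then u else tab (view h t p))" for p
    by (auto simp: tab_def view_def upd_cells_def ys intro!: nth_equalityI)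
  moreover have "upd_cells (Suc w) t h ys 0 p = (if p = h 0 then a else t 0 p)" for p
    by (simp add: upd_cells_def ys)
  moreover have "flags_at n 0 = 2"
    using assms(1) by (simp add: flags_at_def flags_def)
  ultimately show ?thesis
    by (auto simp: upd_cells_def[of 2] enc_apply heads_def merge_code_def ys(1) fun_eq_iff less_2_cases_iff)
qed

lemma upd_within:
  assumes "t \<in> tapes_within h n" "0 < n" "ys \<in> cells (Suc w) (qalph M)"
  shows "upd_cells (Suc w) t h ys \<in> tapes_within h n"
  using assms by (auto simp: tapes_within_def upd_cells_def cells_def split: if_splits)

lemma read_within:
  assumes "t \<in> tapes_within h n"
  shows "read_cells (Suc w) t h \<in> cells (Suc w) (qalph M)"
  using assms by (auto simp: tapes_within_def read_cells_def cells_def)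

text \<open>On encoded tapes the centre carries the flag \<open>2\<close>, so the lifted operator
  acts through the block of label \<open>2\<close>, a copy of that of \<open>A\<close>. No nonzero
  entry connects this block with other pairs of cells.\<close>

lemma lift_op_represents:
  assumes r: "represents (tapes_within h n) (enc h n) \<phi> \<phi>'" and n: "0 < n"
    and A: "admissible (ntapes M) (qalph M) A"
  shows "represents (tapes_within h n) (enc h n) (apply_op (ntapes M) (qalph M) (snd A d) h \<phi>)
    (apply_op 2 alph2 (snd (lift_op A) d) (heads (h 0) 0) \<phi>')"
proof -
  let ?S = "tapes_within h n" and ?K = "cells (Suc w) (qalph M)" and ?h = "heads (h 0) 0"
  let ?\<chi> = "apply_op (ntapes M) (qalph M) (snd A d) h \<phi>"
  let ?\<chi>' = "apply_op 2 alph2 (snd (lift_op A) d) ?h \<phi>'"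
  let ?V = "merge_code ` (?K \<times> {0, 1, 2})"
  have on: "snd (lift_op A) d (merge_code (x, l)) (merge_code (y, l')) = (if l = l' then snd A d x y else 0)"
    if "x \<in> ?K" "y \<in> ?K" "l \<in> {0, 1, 2}" "l' \<in> {0, 1, 2}" for x y l l'
    unfolding lift_op_def ntapes by (rule embed_transfo_on_image[OF inj_merge_code that])
  have off: "x = y" if "x \<notin> ?V \<or> y \<notin> ?V" "snd (lift_op A) d x y \<noteq> 0" for x y
    using that(2) unfolding lift_op_def ntapes embed_transfo_off_image[OF that(1)] by (simp split: if_splits)
  have A0: "snd A d x y = 0" if "x \<notin> ?K \<or> y \<notin> ?K" for x y
    using A that by (auto simp: admissible_def ntapes)
  have outside: "?\<chi> t = 0" if t: "t \<notin> ?S" for t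
  proof (rule ccontr)
    assume "?\<chi> t \<noteq> 0"
    then obtain ys where ys: "ys \<in> ?K" "snd A d (read_cells (Suc w) t h) ys \<noteq> 0" "\<phi> (upd_cells (Suc w) t h ys) \<noteq> 0"
      unfolding apply_op_def ntapes by (auto elim: sum.not_neutral_contains_not_neutral)
    have rd: "read_cells (Suc w) t h \<in> ?K" using A0 ys(2) by blast
    have "upd_cells (Suc w) t h ys \<in> ?S" using r ys(3) unfolding represents_def by blast
    from upd_within[OF this n rd] show False using t by (simp add: upd_upd_cells upd_read_cells)
  qed
  have forward: "?\<chi>' (enc h n t) = ?\<chi> t" if t: "t \<in> ?S" for t
  proof -
    let ?r = "read_cells (Suc w) t h" and ?m = "\<lambda>ys. merge_code (ys, 2)"
    let ?g = "\<lambda>zs. snd (lift_op A) d (merge_code (?r, 2)) zs * \<phi>' (upd_cells 2 (enc h n t) ?h zs)"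
    note rK = read_within[OF t]
    have inj: "inj_on ?m ?K" using inj_merge_code by (auto simp: inj_on_def)
    have sub: "?m ` ?K \<subseteq> cells 2 alph2" using merge_code_cells by (auto simp: image_subset_iff)
    \<comment> \<open>Another flag is another label, and a pair off the image is connected with
      itself at most.\<close>
    have "snd (lift_op A) d (?m ?r) zs = 0" if zs: "zs \<notin> ?m ` ?K" for zs
    proof (cases "zs \<in> ?V")
      case True
      then obtain ys l where z: "zs = merge_code (ys, l)" "ys \<in> ?K" "l \<in> {0, 1, 2}" by auto
      then have "l \<noteq> 2" using zs by auto
      then show ?thesis using on[OF rK z(2) _ z(3), of 2] z by simp
    next
      case False
      moreover have "?m ?r \<in> ?m ` ?K" using rK by simp
      ultimately show ?thesis using off zs by metis
    qed
    then have "?\<chi>' (enc h n t) = (\<Sum>zs\<in>?m ` ?K. ?g zs)"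
      unfolding apply_op_def read_enc[OF n]
      by (intro sum.mono_neutral_right finite_cells finite_alph2 sub) auto
    also have "\<dots> = (\<Sum>ys\<in>?K. ?g (?m ys))"
      by (simp add: sum.reindex[OF inj])
    also have "\<dots> = (\<Sum>ys\<in>?K. snd A d ?r ys * \<phi> (upd_cells (Suc w) t h ys))"
    proof (intro sum.cong refl)
      fix ys assume ys: "ys \<in> ?K"
      have "\<phi>' (enc h n (upd_cells (Suc w) t h ys)) = \<phi> (upd_cells (Suc w) t h ys)"
        using r upd_within[OF t n ys] unfolding represents_def by blast
      then show "?g (?m ys) = snd A d ?r ys * \<phi> (upd_cells (Suc w) t h ys)"
        using on[OF rK ys, of 2 2] by (simp add: upd_enc[OF n ys])
    qed
    also have "\<dots> = ?\<chi> t" by (simp add: apply_op_def ntapes)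
    finally show ?thesis .
  qed
  have "?\<chi>' t' = 0" if t': "t' \<notin> enc h n ` ?S" for t'
  proof (rule ccontr)
    assume "?\<chi>' t' \<noteq> 0"
    then obtain zs where zs: "zs \<in> cells 2 alph2" "snd (lift_op A) d (read_cells 2 t' ?h) zs \<noteq> 0"
      "\<phi>' (upd_cells 2 t' ?h zs) \<noteq> 0"
      unfolding apply_op_def by (auto elim: sum.not_neutral_contains_not_neutral)
    have "upd_cells 2 t' ?h zs \<in> enc h n ` ?S" using r zs(3) unfolding represents_def by blast
    then obtain t where t: "t \<in> ?S" "upd_cells 2 t' ?h zs = enc h n t" by blast
    have z: "zs = merge_code (read_cells (Suc w) t h, 2)"
      using read_upd_cells[OF cells_length[OF zs(1)], of t' ?h] t(2) read_enc[OF n] by metis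
    note rK = read_within[OF t(1)]
    \<comment> \<open>A nonzero entry stays within its block, so the target pair has flag
      \<open>2\<close> as well.\<close>
    have "\<exists>ys\<in>?K. read_cells 2 t' ?h = merge_code (ys, 2)"
    proof (cases "read_cells 2 t' ?h \<in> ?V")
      case True
      then obtain ys l where y: "read_cells 2 t' ?h = merge_code (ys, l)" "ys \<in> ?K" "l \<in> {0, 1, 2}" by auto
      then have "l = 2" using zs(2) on[OF y(2) rK y(3), of 2] unfolding z by (simp split: if_splits)
      then show ?thesis using y by blast
    next
      case False
      then show ?thesis using off zs(2) z rK by blast
    qed
    then obtain ys where ys: "ys \<in> ?K" "read_cells 2 t' ?h = merge_code (ys, 2)" by blast
    have "t' = upd_cells 2 (enc h n t) ?h (merge_code (ys, 2))"
      using upd_upd_cells[of 2 t' ?h zs "merge_code (ys, 2)"] upd_read_cells[of 2 t' ?h] t(2) ys(2) by metis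
    then have "t' = enc h n (upd_cells (Suc w) t h ys)" by (simp add: upd_enc[OF n ys(1)])
    then show False using t' upd_within[OF t(1) n ys(1)] by blast
  qed
  then show ?thesis
    unfolding represents_def using inj_enc outside forward by blast
qed


section \<open>Simulating whole histories\<close>

text \<open>\<open>m\<close> is the number of steps of \<open>M\<close> simulated so far; it bounds the visited region.\<close>

definition simulates :: "nat \<Rightarrow> config \<Rightarrow> config \<Rightarrow> bool" where
  "simulates m C C' \<longleftrightarrow> (case C of (p, c, h, \<phi>) \<Rightarrow> case C' of (p', c', h', \<phi>') \<Rightarrow>
     p \<in> TSt ` states M \<union> {TYes, TNo, THalt} \<and> p' = target_code p \<and> c' = c \<and> h' = heads (h 0) 0 \<and>
     represents (tapes_within h m) (enc h m) \<phi> \<phi>')"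

lemma delta2_apply:
  "delta M q c = (p, D, A) \<Longrightarrow> delta2 (st q c 4) 2 = (target_code p, [D ! 0, DStay], lift_op A)"
  by (simp add: delta2_def st_def stop_flag_def)

text \<open>Only the action after the prelude carries an outcome of \<open>M\<close>. The last
  clause excludes the surplus outcomes of \<open>M2\<close>: \<open>lift_op\<close> adds at most the
  outcome \<open>0\<close>, which belongs to \<open>calph M\<close>.\<close>

lemma simulate_step:
  assumes sim: "simulates m (TSt q, c, h, \<phi>) C'" and c: "c \<in> calph M"
  shows "\<exists>n c1 h1 \<phi>1. forced M2 C' (prelude m) (TSt n, c1, h1, \<phi>1) \<and>
    (\<forall>d. simulates (Suc m) (step M q (TSt q, c, h, \<phi>) d) (step M2 n (TSt n, c1, h1, \<phi>1) d)) \<and>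
    (\<forall>d. d \<notin> calph M \<longrightarrow> (\<exists>p' c' h'. step M2 n (TSt n, c1, h1, \<phi>1) d = (p', c', h', \<lambda>t. 0)))"
proof -
  from sim obtain \<phi>' where q: "q \<in> states M"
    and C': "C' = (TSt (st q 0 5), c, heads (h 0) 0, \<phi>')"
    and r: "represents (tapes_within h m) (enc h m) \<phi> \<phi>'"
    by (cases C') (auto simp: simulates_def target_code_def)
  obtain p D A where d: "delta M q c = (p, D, A)" by (metis prod_cases3)
  note wfd = delta_wf[OF q c d]
  from shifting_phase[OF r q c d] obtain \<phi>1
    where f: "forced M2 C' (prelude m) (TSt (st q c 4), 2, heads (h 0) 0, \<phi>1)"
      and r1: "represents (tapes_within h m) (enc (moved D h) (Suc m)) \<phi> \<phi>1"
    unfolding C' by blast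
  have r2: "represents (tapes_within (moved D h) (Suc m)) (enc (moved D h) (Suc m)) \<phi> \<phi>1"
    by (rule represents_mono[OF r1 tapes_within_moved inj_enc])
  have s2: "step M2 (st q c 4) (TSt (st q c 4), 2, heads (h 0) 0, \<phi>1) e = (target_code p, e, heads (moved D h 0) 0,
      apply_op 2 alph2 (snd (lift_op A) e) (heads (moved D h 0) 0) \<phi>1)" for e
    by (simp add: step_def delta2_apply[OF d] move_two Let_def moved_apply) (simp add: dir_val_def)
  have s1: "step M q (TSt q, c, h, \<phi>) e = (p, e, moved D h, apply_op (ntapes M) (qalph M) (snd A e) (moved D h) \<phi>)" for e
    by (simp add: step_def d moved_def Let_def)
  have "simulates (Suc m) (step M q (TSt q, c, h, \<phi>) e) (step M2 (st q c 4) (TSt (st q c 4), 2, heads (h 0) 0, \<phi>1) e)" for e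
    using lift_op_represents[OF r2 _ wfd(3)] wfd(1) by (simp add: simulates_def s1 s2)
  moreover have "snd (lift_op A) e = (\<lambda>x y. 0)" if "e \<notin> calph M" for e
  proof -
    have "e \<noteq> 0" using that zero_calph by metis
    then have "e \<notin> fst (lift_op A)"
      using that wfd(4) by (auto simp: lift_op_def embed_transfo_def)
    then show ?thesis using lift_op_admissible[OF wfd(3)] unfolding admissible_def by blast
  qed
  then have "\<exists>p' c' h'. step M2 (st q c 4) (TSt (st q c 4), 2, heads (h 0) 0, \<phi>1) e = (p', c', h', \<lambda>t. 0)"
    if "e \<notin> calph M" for e
    using that by (simp add: s2 apply_op_def)
  ultimately show ?thesis using f by blast
qed

fun expand :: "nat \<Rightarrow> nat list \<Rightarrow> nat list" where
  "expand m [] = []"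
| "expand m (c # cs) = prelude m @ c # expand (Suc m) cs"

text \<open>The block for step \<open>i\<close>, a prelude and an outcome, has length
  \<open>10 * i + 10\<close>, and \<open>5 * m * (m + 1)\<close> is the sum of these lengths over
  \<open>i < m\<close>.\<close>

lemma length_expand:
  "length (expand m cs) + 5 * m * (m + 1) = 5 * (m + length cs) * (m + length cs + 1)"
proof (induction cs arbitrary: m)
  case (Cons c cs)
  show ?case using Cons[of "Suc m"] by (simp add: length_prelude algebra_simps)
qed simp

lemma set_expand: "set (expand m cs) \<subseteq> set cs \<union> {0, 1, 2}"
proof (induction cs arbitrary: m)
  case (Cons c cs)
  show ?case using Cons[of "Suc m"] set_prelude[of m] by (simp only: expand.simps set_append set_simps) blast
qed simp

lemma expand_inj: "expand m cs = expand m ds \<Longrightarrow> cs = ds"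
proof (induction cs arbitrary: m ds)
  case Nil
  then show ?case by (cases ds) auto
next
  case (Cons c cs)
  then show ?case by (cases ds) auto
qed

lemma expand_forward:
  assumes "exec M C cs = Some Cf" "set cs \<subseteq> calph M" "simulates m C C'" "fst (snd C) \<in> calph M"
  shows "\<exists>Cf'. exec M2 C' (expand m cs) = Some Cf' \<and> simulates (m + length cs) Cf Cf'"
  using assms
proof (induction cs arbitrary: m C C')
  case (Cons d cs)
  obtain p c h \<phi> where C: "C = (p, c, h, \<phi>)" by (metis prod_cases4)
  from Cons.prems(1) obtain q where p: "p = TSt q" and e: "exec M (step M q C d) cs = Some Cf"
    by (cases p) (auto simp: C)
  from simulate_step[of m q c h \<phi> C'] Cons.prems(3,4)
  obtain n c1 h1 \<phi>1 where f: "forced M2 C' (prelude m) (TSt n, c1, h1, \<phi>1)"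
    and s: "simulates (Suc m) (step M q C d) (step M2 n (TSt n, c1, h1, \<phi>1) d)"
    by (auto simp: C p)
  have "fst (snd (step M q C d)) = d"
    by (simp add: step_def C Let_def split: prod.split)
  then have "\<exists>Cf'. exec M2 (step M2 n (TSt n, c1, h1, \<phi>1) d) (expand (Suc m) cs) = Some Cf' \<and>
      simulates (Suc m + length cs) Cf Cf'"
    using Cons.IH[OF e _ s] Cons.prems(2) by simp
  then show ?case using f by (auto simp: exec_append forced_def)
qed auto

lemma exec_prefix_running:
  assumes "exec M' C (xs @ ys) = Some Cf" "ys \<noteq> []" "exec M' C xs = Some C1"
  shows "\<exists>q. fst C1 = TSt q"
proof -
  have "exec M' C1 ys = Some Cf" using assms by (simp add: exec_append)
  then show ?thesis using assms(2) by (cases ys; cases "fst C1") auto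
qed

text \<open>Since preludes are forced, a nonzero history either ends within the current prelude or
  completes it and goes on with an outcome in \<open>calph M\<close>, to which the induction
  applies. In the former case \<open>M2\<close> is still running, so the history has no share in the
  output.\<close>

lemma expand_backward:
  assumes "exec M2 C' cs' = Some (p, c, h, \<phi>')" "\<phi>' \<noteq> (\<lambda>t. 0)" "simulates m C C'" "fst (snd C) \<in> calph M"
  shows "\<exists>cs Cf r. set cs \<subseteq> calph M \<and> exec M C cs = Some Cf \<and> cs' = expand m cs @ r \<and>
    (r = [] \<and> simulates (m + length cs) Cf (p, c, h, \<phi>') \<or>
     0 < length r \<and> length r \<le> length (prelude (m + length cs)) \<and> p \<in> range TSt)"
  using assms
proof (induction cs' arbitrary: m C C' rule: length_induct)
  case (1 cs')
  note prems = "1.prems"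
  show ?case
  proof (cases "cs' = []")
    case True
    then show ?thesis using prems by (intro exI[of _ "[]"] exI[of _ C]) auto
  next
    case False
    obtain p0 c0 h0 \<phi> where C: "C = (p0, c0, h0, \<phi>)" by (metis prod_cases4)
    obtain p0' c0' h0' \<phi>0' where C': "C' = (p0', c0', h0', \<phi>0')" by (metis prod_cases4)
    have pc: "p0' = target_code p0" using prems(3) by (simp add: simulates_def C C')
    obtain q where p0: "p0 = TSt q"
      using prems(1) False pc by (cases cs'; cases p0) (auto simp: C' target_code_def)
    from simulate_step[of m q c0 h0 \<phi> C'] prems(3,4)
    obtain n c1 h1 \<phi>1 where f: "forced M2 C' (prelude m) (TSt n, c1, h1, \<phi>1)"
      and s: "\<And>d. simulates (Suc m) (step M q C d) (step M2 n (TSt n, c1, h1, \<phi>1) d)"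
      and z: "\<And>d. d \<notin> calph M \<Longrightarrow> \<exists>p' c' h'. step M2 n (TSt n, c1, h1, \<phi>1) d = (p', c', h', \<lambda>t. 0)"
      by (auto simp: C p0)
    from f prems(1,2) obtain r where r: "prelude m = cs' @ r \<or> cs' = prelude m @ r"
      unfolding forced_def by blast
    have ex: "exec M2 C' (prelude m) = Some (TSt n, c1, h1, \<phi>1)" using f by (simp add: forced_def)
    show ?thesis
    proof (cases "\<exists>r. prelude m = cs' @ r")
      case True
      then obtain r where r: "prelude m = cs' @ r" by blast
      \<comment> \<open>A halting state inside the prelude would block the rest of it.\<close>
      have "p \<in> range TSt"
      proof (cases "r = []")
        case True
        then show ?thesis using ex prems(1) r by simp
      next
        case False
        from exec_prefix_running[OF ex[unfolded r] False prems(1)] show ?thesis by auto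
      qed
      then show ?thesis using False r
        by (intro exI[of _ "[]"] exI[of _ C] exI[of _ cs']) auto
    next
      case False
      then obtain r where r: "cs' = prelude m @ r" "r \<noteq> []" using r by auto
      then obtain d ds where rd: "r = d # ds" by (cases r) auto
      have e: "exec M2 (step M2 n (TSt n, c1, h1, \<phi>1) d) ds = Some (p, c, h, \<phi>')"
        using prems(1) ex by (simp add: r rd exec_append)
      have d: "d \<in> calph M"
      proof (rule ccontr)
        assume "d \<notin> calph M"
        from z[OF this] obtain p' c' h' where "step M2 n (TSt n, c1, h1, \<phi>1) d = (p', c', h', \<lambda>t. 0)"
          by blast
        with e have "\<phi>' = (\<lambda>t. 0)" using exec_zero by metis
        then show False using prems(2) by simp
      qed
      have fs: "fst (snd (step M q C d)) \<in> calph M"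
        using d by (simp add: step_def C Let_def split: prod.split)
      have "length ds < length cs'" by (simp add: r rd)
      with "1.IH" e prems(2) s fs obtain cs Cf r' where
        *: "set cs \<subseteq> calph M" "exec M (step M q C d) cs = Some Cf" "ds = expand (Suc m) cs @ r'"
        "r' = [] \<and> simulates (Suc m + length cs) Cf (p, c, h, \<phi>') \<or>
         0 < length r' \<and> length r' \<le> length (prelude (Suc m + length cs)) \<and> p \<in> range TSt"
        by meson
      show ?thesis
        using * d by (intro exI[of _ "d # cs"] exI[of _ Cf] exI[of _ r']) (auto simp: r rd C p0)
    qed
  qed
qed

section \<open>Initial configurations, running time and output\<close>

lemma init_tapes_within:
  assumes "u \<in> input_words (qalph M - {0}) n"
  shows "init_tapes u \<in> tapes_within (\<lambda>_. 0) 0"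
proof -
  have "u ! i \<in> qalph M" if "i < length u" for i
    using assms nth_mem[OF that] by (auto simp: input_words_def)
  then have "init_tapes u j p \<in> qalph M" for j p
    using zero_qalph by (auto simp: init_tapes_def nat_diff_distrib' nat_less_iff)
  then show ?thesis by (auto simp: tapes_within_def init_tapes_def)
qed

text \<open>Blank blocks with the fresh flag are coded by \<open>0\<close>, so both machines start
  on literally the same tapes.\<close>

lemma enc_init_tapes: "enc (\<lambda>_. 0) 0 (init_tapes u) = init_tapes u"
proof -
  have others: "init_tapes u j p = 0" if "j \<noteq> 0" for j p
    using that by (simp add: init_tapes_def)
  then have "view (\<lambda>_. 0) (init_tapes u) p = (\<lambda>_. 0)" for p
    by (simp add: view_def[abs_def])
  then have "tab (view (\<lambda>_. 0) (init_tapes u) p) = pad" for p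
    by simp
  then show ?thesis by (simp add: enc_apply flags_at_def fun_eq_iff others)
qed

lemma simulates_init:
  assumes "valid_input (qalph M - {0}) n \<psi>"
  shows "simulates 0 (init_config M n \<psi>) (init_config M2 n \<psi>)"
proof -
  let ?W = "input_words (qalph M - {0}) n" and ?W2 = "input_words (alph2 - {0}) n"
  let ?h = "\<lambda>_::nat. 0::int"
  let ?\<phi> = "\<lambda>t. \<Sum>u\<in>?W. if t = init_tapes u then \<psi> u else 0"
  let ?\<phi>2 = "\<lambda>t. \<Sum>u\<in>?W2. if t = init_tapes u then \<psi> u else 0"
  have fin: "finite ?W2"
    using finite_cells[of "alph2 - {0}" n] finite_alph2 by (simp add: input_words_def cells_def)
  have W: "?W \<subseteq> ?W2" using qalph_subset by (auto simp: input_words_def)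
  \<comment> \<open>A valid input vanishes on the words that use symbols outside
    \<open>qalph M\<close>.\<close>
  have eq: "?\<phi>2 t = (\<Sum>u\<in>?W. if t = init_tapes u then \<psi> u else 0)" for t
    using fin W assms by (intro sum.mono_neutral_right) (auto simp: valid_input_def)
  have inv: "enc ?h 0 t = init_tapes u \<longleftrightarrow> t = init_tapes u" if "t \<in> tapes_within ?h 0" "u \<in> ?W" for t u
    using inj_enc[of ?h 0 0] that init_tapes_within enc_init_tapes unfolding inj_on_def by metis
  have "represents (tapes_within ?h 0) (enc ?h 0) ?\<phi> ?\<phi>2"
    unfolding represents_def eq
  proof (intro conjI allI ballI impI)
    show "inj_on (enc ?h 0) (tapes_within ?h 0)" by (rule inj_enc)
  next
    fix t assume "t \<notin> tapes_within ?h 0"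
    then show "?\<phi> t = 0" using init_tapes_within by (intro sum.neutral) auto
  next
    fix t assume "t \<in> tapes_within ?h 0"
    then show "?\<phi> (enc ?h 0 t) = ?\<phi> t" by (intro sum.cong refl) (simp add: inv)
  next
    fix t assume t: "t \<notin> enc ?h 0 ` tapes_within ?h 0"
    have "t \<noteq> init_tapes u" if "u \<in> ?W" for u
      using t init_tapes_within[OF that] enc_init_tapes[of u] by (metis image_eqI)
    then show "?\<phi> t = 0" by (intro sum.neutral) auto
  qed
  moreover have "heads 0 0 = (\<lambda>_. 0)" by (simp add: heads_def fun_eq_iff)
  ultimately show ?thesis
    using start_states by (simp add: simulates_def init_config_def target_code_def)
qed

lemma simulates_target:
  assumes "simulates m (p, c, h, \<phi>) (p', c', h', \<phi>')"
  shows "p' = target_code p" "weight \<phi>' = weight \<phi>" "tape1_rho \<phi>' = tape1_rho \<phi>"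
    "\<phi>' = (\<lambda>t. 0) \<longleftrightarrow> \<phi> = (\<lambda>t. 0)"
proof -
  have r: "represents (tapes_within h m) (enc h m) \<phi> \<phi>'" and p: "p' = target_code p"
    using assms by (simp_all add: simulates_def)
  show "p' = target_code p" by (rule p)
  show "weight \<phi>' = weight \<phi>" by (rule represents_weight[OF r])
  show "\<phi>' = (\<lambda>t. 0) \<longleftrightarrow> \<phi> = (\<lambda>t. 0)" by (rule represents_zero_iff[OF r])
  show "tape1_rho \<phi>' = tape1_rho \<phi>"
    by (intro ext represents_tape1_rho[OF r]) (simp_all only: enc_tape0 enc_others)
qed

lemma target_code_halting [simp]:
  "target_code p = TYes \<longleftrightarrow> p = TYes" "target_code p = TNo \<longleftrightarrow> p = TNo" "target_code p = THalt \<longleftrightarrow> p = THalt"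
  "target_code TYes = TYes" "target_code TNo = TNo" "target_code THalt = THalt"
  by (auto simp: target_code_def split: target.splits)

lemma init_outcome: "fst (snd (init_config M n \<psi>)) \<in> calph M"
  by (simp add: init_config_def zero_calph)

text \<open>Passing from \<open>l\<close> to \<open>l + 1\<close> outcomes takes
  \<open>10 * l + 10\<close> actions, more than the unfinished block \<open>k\<close> can contain. A
  history of the claimed length therefore ends exactly after outcome number
  \<open>f\<close>.\<close>

lemma history_time_unique:
  assumes "5 * l * (l + 1) + k = 5 * (f::nat) * (f + 1)" "k \<le> 10 * l + 9"
  shows "l = f \<and> k = 0"
proof -
  have mono: "5 * a * (a + 1) \<le> 5 * b * (b + 1)" if "a \<le> b" for a b :: nat
    using that by (intro mult_le_mono) auto
  have "\<not> f < l" using mono[of "Suc f" l] assms(1) by (auto simp: algebra_simps)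
  moreover have "\<not> l < f" using mono[of "Suc l" f] assms by (auto simp: algebra_simps)
  ultimately show ?thesis using assms(1) by simp
qed

lemma operates_in_time_M2:
  assumes "operates_in_time M (qalph M - {0}) f"
  shows "operates_in_time M2 (qalph M - {0}) (\<lambda>n. 5 * f n * (f n + 1))"
  unfolding operates_in_time_def
proof (intro allI impI)
  fix n \<psi> cs'
  assume v: "valid_input (qalph M - {0}) n \<psi>" and cs': "set cs' \<subseteq> calph M2 \<and> length cs' = 5 * f n * (f n + 1)"
  have "weight \<phi>' = 0" if e: "exec M2 (init_config M2 n \<psi>) cs' = Some (TSt q', c, h', \<phi>')" for q' c h' \<phi>'
  proof (cases "\<phi>' = (\<lambda>t. 0)")
    case False
    from expand_backward[OF e False simulates_init[OF v] init_outcome]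
    obtain cs Cf r where *: "set cs \<subseteq> calph M" "exec M (init_config M n \<psi>) cs = Some Cf" "cs' = expand 0 cs @ r"
      "r = [] \<and> simulates (length cs) Cf (TSt q', c, h', \<phi>') \<or> 0 < length r \<and> length r \<le> length (prelude (length cs))"
      by auto
    have "length (expand 0 cs) = 5 * length cs * (length cs + 1)" using length_expand[of 0 cs] by simp
    then have l: "length cs = f n \<and> length r = 0"
      using cs' *(3,4) by (intro history_time_unique) (auto simp: length_prelude)
    obtain p d h \<phi> where Cf: "Cf = (p, d, h, \<phi>)" by (metis prod_cases4)
    have s: "simulates (length cs) (p, d, h, \<phi>) (TSt q', c, h', \<phi>')" using l *(4) Cf by simp
    then obtain q where "p = TSt q"
      using simulates_target(1)[OF s] by (cases p) (auto simp: target_code_def)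
    then have "weight \<phi> = 0"
      using assms v *(1,2) l Cf unfolding operates_in_time_def by fastforce
    then show ?thesis using simulates_target(2)[OF s] by simp
  qed (simp add: weight_def)
  then show "case exec M2 (init_config M2 n \<psi>) cs' of None \<Rightarrow> True
      | Some (p, c, h, \<phi>) \<Rightarrow> \<forall>q. p = TSt q \<longrightarrow> weight \<phi> = 0"
    by (auto split: option.split)
qed

text \<open>A general \<open>\<Phi>\<close> covers the weight and every entry of the output matrix.
  Histories outside the image of \<open>expand 0\<close> end in the zero state, and
  \<open>expand 0\<close> is injective, so the sums agree without any appeal to summability.\<close>

lemma infsum_final_hists:
  fixes \<Phi> :: "qstate \<Rightarrow> 'a::{topological_ab_group_add, t2_space}"
  assumes v: "valid_input (qalph M - {0}) n \<psi>" and res: "res \<in> {TYes, TNo, THalt}"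
    and zero: "\<Phi> (\<lambda>t. 0) = 0"
    and inv: "\<And>m p c h \<phi> p' c' h' \<phi>'. simulates m (p, c, h, \<phi>) (p', c', h', \<phi>') \<Longrightarrow> \<Phi> \<phi>' = \<Phi> \<phi>"
  shows "infsum (\<lambda>cs. \<Phi> (final_qstate M2 n \<psi> cs)) (final_hists M2 n \<psi> res)
    = infsum (\<lambda>cs. \<Phi> (final_qstate M n \<psi> cs)) (final_hists M n \<psi> res)"
proof -
  let ?A = "final_hists M n \<psi> res" and ?B = "final_hists M2 n \<psi> res"
  note sim = simulates_init[OF v]
  have tc: "target_code p = res \<longleftrightarrow> p = res" for p using res by auto
  have fwd: "\<exists>p c h \<phi> p' c' h' \<phi>'. exec M (init_config M n \<psi>) cs = Some (p, c, h, \<phi>) \<and>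
      exec M2 (init_config M2 n \<psi>) (expand 0 cs) = Some (p', c', h', \<phi>') \<and>
      simulates (length cs) (p, c, h, \<phi>) (p', c', h', \<phi>') \<and> p = res \<and> p' = res" if "cs \<in> ?A" for cs
  proof -
    from that obtain c h \<phi> where cs: "set cs \<subseteq> calph M" and e: "exec M (init_config M n \<psi>) cs = Some (res, c, h, \<phi>)"
      by (auto simp: final_hists_def)
    from expand_forward[OF e cs sim init_outcome] obtain Cf' where
      "exec M2 (init_config M2 n \<psi>) (expand 0 cs) = Some Cf'" "simulates (length cs) (res, c, h, \<phi>) Cf'"
      by auto
    moreover obtain p' c' h' \<phi>' where "Cf' = (p', c', h', \<phi>')" by (metis prod_cases4)
    ultimately show ?thesis using e simulates_target(1) tc by blast
  qed
  have sub: "expand 0 cs \<in> ?B" if "cs \<in> ?A" for cs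
  proof -
    have "set cs \<subseteq> calph M" using that by (simp add: final_hists_def)
    then have "set (expand 0 cs) \<subseteq> calph M2" using set_expand[of 0 cs] by (auto simp: calph2_def)
    then show ?thesis using fwd[OF that] by (auto simp: final_hists_def)
  qed
  have neg: "\<Phi> (final_qstate M2 n \<psi> cs') = 0" if "cs' \<in> ?B - expand 0 ` ?A" for cs'
  proof -
    from that obtain c h \<phi>' where e: "exec M2 (init_config M2 n \<psi>) cs' = Some (res, c, h, \<phi>')"
      and nin: "cs' \<notin> expand 0 ` ?A" by (auto simp: final_hists_def)
    have "\<phi>' = (\<lambda>t. 0)"
    proof (rule ccontr)
      assume nz: "\<phi>' \<noteq> (\<lambda>t. 0)"
      from expand_backward[OF e nz sim init_outcome] res
      obtain cs Cf where *: "set cs \<subseteq> calph M" "exec M (init_config M n \<psi>) cs = Some Cf" "cs' = expand 0 cs"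
        "simulates (length cs) Cf (res, c, h, \<phi>')"
        by auto
      obtain p d h0 \<phi> where Cf: "Cf = (p, d, h0, \<phi>)" by (metis prod_cases4)
      have "p = res" using simulates_target(1)[OF *(4)[unfolded Cf]] tc by metis
      then have "cs \<in> ?A" using * Cf by (auto simp: final_hists_def)
      then show False using nin *(3) by blast
    qed
    then show ?thesis by (simp add: final_qstate_def e zero)
  qed
  have "infsum (\<lambda>cs. \<Phi> (final_qstate M2 n \<psi> cs)) ?B
      = infsum (\<lambda>cs. \<Phi> (final_qstate M2 n \<psi> cs)) (expand 0 ` ?A)"
    using sub neg by (intro infsum_cong_neutral) auto
  also have "\<dots> = infsum ((\<lambda>cs. \<Phi> (final_qstate M2 n \<psi> cs)) \<circ> expand 0) ?A"
    by (rule infsum_reindex) (auto simp: inj_on_def dest: expand_inj)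
  also have "\<dots> = infsum (\<lambda>cs. \<Phi> (final_qstate M n \<psi> cs)) ?A"
  proof (rule infsum_cong)
    fix cs assume "cs \<in> ?A"
    from fwd[OF this] show "((\<lambda>cs. \<Phi> (final_qstate M2 n \<psi> cs)) \<circ> expand 0) cs = \<Phi> (final_qstate M n \<psi> cs)"
      using inv by (auto simp: final_qstate_def)
  qed
  finally show ?thesis .
qed

lemma cq_output_M2:
  assumes "valid_input (qalph M - {0}) n \<psi>"
  shows "cq_output M n \<psi> = cq_output M2 n \<psi>"
proof -
  have "weight (\<lambda>t. 0) = 0" "tape1_rho (\<lambda>t. 0) x y = 0" for x y
    by (simp_all add: weight_def tape1_rho_def split: prod.split)
  then show ?thesis
    unfolding cq_output_def
    using infsum_final_hists[OF assms, of _ weight] infsum_final_hists[OF assms, of _ "\<lambda>\<phi>. tape1_rho \<phi> x y" for x y]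
      simulates_target(2,3) by simp
qed

end

theorem theorem2:
  fixes M :: cqtm and f :: "nat \<Rightarrow> nat"
  assumes "wf_cqtm M"
    and "operates_in_time M (qalph M - {0}) f"
  shows "\<exists>M' :: cqtm. \<exists>g :: nat \<Rightarrow> nat.
           wf_cqtm M' \<and> ntapes M' = 2 \<and> qalph M \<subseteq> qalph M' \<and>
           operates_in_time M' (qalph M - {0}) g \<and>
           (\<lambda>n. real (g n)) \<in> O(\<lambda>n. (real (f n))\<^sup>2) \<and>
           (\<forall>n \<psi>. valid_input (qalph M - {0}) n \<psi> \<longrightarrow> cq_output M n \<psi> = cq_output M' n \<psi>)"
proof -
  interpret simulation M by unfold_locales (rule assms(1))
  have "real (5 * k * (k + 1)) \<le> 10 * (real k)\<^sup>2" for k :: nat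
  proof -
    \<comment> \<open>For \<open>k > 0\<close> use \<open>k + 1 \<le> 2 * k\<close>; at
      \<open>k = 0\<close> both sides vanish, so inputs with \<open>f n = 0\<close> are
      covered.\<close>
    have "5 * k * (k + 1) \<le> 10 * k\<^sup>2" by (cases k) (simp_all add: power2_eq_square algebra_simps)
    then have "real (5 * k * (k + 1)) \<le> real (10 * k\<^sup>2)" by (rule of_nat_mono)
    then show ?thesis by simp
  qed
  then have "(\<lambda>n. real (5 * f n * (f n + 1))) \<in> O(\<lambda>n. (real (f n))\<^sup>2)"
    by (intro bigoI[of _ 10] always_eventually allI) (simp only: real_norm_def abs_of_nonneg of_nat_0_le_iff zero_le_power2)
  then show ?thesis
    using wf_M2 qalph_subset operates_in_time_M2[OF assms(2)] cq_output_M2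
    by (intro exI[of _ M2] exI[of _ "\<lambda>n. 5 * f n * (f n + 1)"]) simp
qed

end
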